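(* Let $(X,\rho)$ be a compact metric space, let $Q:X\to(0,\infty)$ be a bounded function, and let $\nu$ be an Ahlfors $Q$-regular Borel measure on $X$. Then $Q(x)=\dim_{\mathrm{loc}}(x)$ for all $x\in X$, and $\nu$ is strongly equivalent to the local Hausdorff measure $H_{\mathrm{loc}}$, i.e. $\nu\simeq H_{\mathrm{loc}}$.
   Context: $B_r(x)$ is the open ball of radius $r$ about $x$, and $|A|=\sup\{\rho(x,y): x,y\in A\}\in[0,\infty]$ is the diameter of $A\subset X$. Carathéodory construction: for $\tau:\mathcal{P}(X)\to[0,\infty]$ with $\tau(\emptyset)=0$, put $\mu^*_{\tau,\delta}(A)=\inf\{\sum_{U\in\mathcal U}\tau(U)\}$, the infimum over all at most countable families $\mathcal U$ of subsets of $X$ with $|U|\le\delta$ for $U\in\mathcal U$ and $A\subset\bigcup\mathcal U$ (and $\inf\emptyset=\infty$), and $\mu^*_\tau(A)=\sup_{\delta>0}\mu^*_{\tau,\delta}(A)$. This is a metric outer measure, and $\mu_\tau$ denotes its restriction to the Borel $\sigma$-algebra. For $0\le s<\infty$, $H^s$ is the ($s$-dimensional Hausdorff) measure obtained from $\tau(U)=|U|^s$ for $U\ne\emptyset$, $\tau(\emptyset)=0$ (with $0^0=1$); for arbitrary sets $A\subset X$, $H^s(A)$ denotes the outer measure. The Hausdorff dimension of $A\subset X$ is $\dim(A)=\inf\{s\ge 0: H^s(A)=0\}\in[0,\infty]$. The local Hausdorff dimension is $\dim_{\mathrm{loc}}(x)=\inf\{\dim(U): U\text{ an open neighborhood of }x\}$.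 The local Hausdorff measure $H_{\mathrm{loc}}$ is $\mu_\tau$ for $\tau(U)=|U|^{\dim(U)}$ if $U\neq\emptyset$, $\tau(\emptyset)=0$ (conventions: $0^0=1$, and $t^\infty=0$ for $0\le t<1$; only sets of small diameter matter). A Borel measure $\nu$ is Ahlfors $Q$-regular if there is a constant $C>0$ such that $\frac1C\nu(B_r(x))\le r^{Q(x)}\le C\nu(B_r(x))$ for all $x\in X$ and $0<r\le|X|$. Borel measures $\mu,\nu$ on $X$ are strongly equivalent, $\mu\simeq\nu$, if there is $C>0$ with $\frac1C\nu(E)\le\mu(E)\le C\nu(E)$ for every Borel set $E$.
   Formalization: X is assumed to have at least two points: for a one-point X, |X|=0 makes Ahlfors regularity vacuous, so Q=1, ν=0 qualify while dim_loc=0, and the claim fails for every such Q>0; the empty space, where the claim is vacuous, is also not covered. *)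

theory Defs
  imports "HOL-Analysis.Analysis"
begin

(* The metric space X is a whole type of class metric_space; P(X) is the type 'a set. *)

(* The library's real-valued "diameter" is unspecified on unbounded sets. *)
definition ediam :: "'a::metric_space set \<Rightarrow> ennreal" where
  "ediam A = (SUP p\<in>A \<times> A. ennreal (dist (fst p) (snd p)))"

(* t^s on [0,\<infinity>] with 0^0 = 1 (the real powr has 0 powr 0 = 0) and t^\<infinity> = 0 for t < 1.
   The values for t = \<infinity>, and for s = \<infinity> with t \<ge> 1, play no role in the constructions
   below, since there t is a diameter and only arbitrarily small diameters matter. *)
definition epow :: "ennreal \<Rightarrow> ennreal \<Rightarrow> ennreal" where
  "epow t s =
    (if s = 0 then 1
     else if s = \<infinity> then (if t < 1 then 0 else if t = 1 then 1 else \<infinity>)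
     else if t = \<infinity> then \<infinity>
     else ennreal (enn2real t powr enn2real s))"

definition covers :: "real \<Rightarrow> 'a::metric_space set \<Rightarrow> 'a set set set" where
  "covers \<delta> A = {\<U>. countable \<U> \<and> (\<forall>U\<in>\<U>. ediam U \<le> ennreal \<delta>) \<and> A \<subseteq> \<Union>\<U>}"

definition cara_pre :: "('a::metric_space set \<Rightarrow> ennreal) \<Rightarrow> real \<Rightarrow> 'a set \<Rightarrow> ennreal" where
  "cara_pre \<tau> \<delta> A = (INF \<U>\<in>covers \<delta> A. \<Sum>\<^sub>\<infinity>U\<in>\<U>. \<tau> U)"

definition cara_outer :: "('a::metric_space set \<Rightarrow> ennreal) \<Rightarrow> 'a set \<Rightarrow> ennreal" where
  "cara_outer \<tau> A = (SUP \<delta>\<in>{0<..}. cara_pre \<tau> \<delta> A)"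

(* measure_of yields the zero measure when its set function is not countably additive on the
   given sigma-algebra. This does not happen if \<tau> {} = 0: then cara_outer \<tau> is a metric outer
   measure, hence countably additive on the Borel sets by Caratheodory's criterion. *)
definition cara_measure :: "('a::metric_space set \<Rightarrow> ennreal) \<Rightarrow> 'a measure" where
  "cara_measure \<tau> = measure_of UNIV (sets borel) (cara_outer \<tau>)"

definition hausdorff_outer :: "real \<Rightarrow> 'a::metric_space set \<Rightarrow> ennreal" where
  "hausdorff_outer s = cara_outer (\<lambda>U. if U = {} then 0 else epow (ediam U) (ennreal s))"

definition hausdorff_dim :: "'a::metric_space set \<Rightarrow> ennreal" where
  "hausdorff_dim A = (INF s\<in>{s::real. 0 \<le> s \<and> hausdorff_outer s A = 0}. ennreal s)"

definition local_dim :: "'a::metric_space \<Rightarrow> ennreal" where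
  "local_dim x = (INF U\<in>{U. open U \<and> x \<in> U}. hausdorff_dim U)"

definition local_hausdorff_measure :: "'a::metric_space measure" where
  "local_hausdorff_measure =
    cara_measure (\<lambda>U. if U = {} then 0 else epow (ediam U) (hausdorff_dim U))"

definition borel_measure :: "'a::topological_space measure \<Rightarrow> bool" where
  "borel_measure \<nu> \<longleftrightarrow> sets \<nu> = sets borel"

definition ahlfors_regular :: "('a::metric_space \<Rightarrow> real) \<Rightarrow> 'a measure \<Rightarrow> bool" where
  "ahlfors_regular Q \<nu> \<longleftrightarrow>
    (\<exists>C::real. C > 0 \<and>
      (\<forall>x r. 0 < r \<and> ennreal r \<le> ediam (UNIV :: 'a set) \<longrightarrow>
        ennreal (1 / C) * emeasure \<nu> (ball x r) \<le> ennreal (r powr Q x) \<and>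
        ennreal (r powr Q x) \<le> ennreal C * emeasure \<nu> (ball x r)))"

definition strongly_equivalent ::
    "'a::topological_space measure \<Rightarrow> 'a measure \<Rightarrow> bool" where
  "strongly_equivalent \<mu> \<nu> \<longleftrightarrow>
    (\<exists>C::real. C > 0 \<and>
      (\<forall>E\<in>sets borel.
        ennreal (1 / C) * emeasure \<nu> E \<le> emeasure \<mu> E \<and>
        emeasure \<mu> E \<le> ennreal C * emeasure \<nu> E))"

end

theory Submission
  imports Defs
begin

text \<open>
  Write \<open>r\<close> for a small radius and \<open>\<tau>(U)\<close> for the diameter of \<open>U\<close> raised to the power \<open>dim U\<close>.
  The theorem rests on one comparison: for balls, \<open>\<tau>(ball x r)\<close>, \<open>r powr Q x\<close> and \<open>\<nu> (ball x r)\<close>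
  agree up to constants.

  The exponent may vary from point to point, but not by much. If \<open>dist x y \<le> r\<close>, then
  \<open>ball x r \<subseteq> ball y (2 * r)\<close>, and the regularity of \<open>\<nu>\<close> at both centres gives
  \<open>r powr Q x \<le> K * r powr Q y\<close> (\<open>powr_exponent_compare\<close>). Equivalently, \<open>Q\<close> oscillates by at
  most \<open>osc r = ln K / ln (1 / r)\<close> at distance \<open>r\<close>. Hence \<open>Q\<close> is continuous, and replacing
  \<open>Q x\<close> by its value anywhere in a set of diameter \<open>r\<close> around \<open>x\<close> costs only a factor \<open>K\<close>
  in \<open>r powr Q x\<close>.

  Dimensions are controlled by \<open>Q\<close>. If \<open>Q \<le> q\<close> on \<open>A\<close>, then a maximal separated subset of \<open>A\<close> at
  scale \<open>r\<close> carries disjoint balls of measure at least of order \<open>r powr q\<close>; as \<open>\<nu>\<close> is finite, there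
  are at most of order \<open>r powr (- q)\<close> of them, so \<open>dim A \<le> q\<close> (\<open>hausdorff_dim_le\<close>). If \<open>Q \<ge> q\<close> on \<open>A\<close> and
  \<open>A\<close> has positive measure, then every set meeting \<open>A\<close> has measure at most of order its diameter to
  any power \<open>s \<le> q\<close>, so \<open>A\<close> cannot be covered cheaply and \<open>dim A \<ge> q\<close> (\<open>hausdorff_dim_ge\<close>).
  Applied to small balls, with \<open>Q\<close> continuous, these two bounds give \<open>local_dim x = Q x\<close>.

  The same two arguments compare the measures. A set \<open>U\<close> of diameter \<open>d > 0\<close> containing \<open>x\<close> has
  \<open>\<nu>\<close>-measure at most of order \<open>d powr Q x\<close>, and \<open>dim U \<le> Q x + osc d\<close>, so \<open>\<nu>\<close> of \<open>U\<close> is bounded by a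
  multiple of \<open>\<tau>(U)\<close>; summing over a cover bounds \<open>\<nu>\<close> by the local Hausdorff outer measure
  (\<open>emeasure_le_local_outer\<close>). Conversely, a closed set \<open>F\<close> is covered by the balls of a separated net, whose
  \<open>\<tau>\<close>-values sum to at most a multiple of the measure of a small neighbourhood of \<open>F\<close>; by
  compactness that measure is close to \<open>\<nu> F\<close> (\<open>local_outer_le_emeasure_closed\<close>). Going through
  closed sets in this way takes the place of a Vitali covering argument. The bound
  passes to Borel sets because a finite Borel measure on a metric space is determined from within by
  closed sets (\<open>emeasure_le_of_closed\<close>). That the local Hausdorff outer measure is a measure on the
  Borel sets at all is Caratheodory's criterion for metric outer measures
  (\<open>emeasure_cara_measure\<close>).
\<close>

section \<open>Sums over index sets in the extended nonnegative reals\<close>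

lemma infsum_ennreal_eq_SUP:
  fixes f :: "'b \<Rightarrow> ennreal"
  shows "infsum f A = (SUP F\<in>{F. finite F \<and> F \<subseteq> A}. sum f F)"
  by (rule nonneg_infsum_complete) simp

lemma sum_le_infsum_ennreal:
  fixes f :: "'b \<Rightarrow> ennreal"
  assumes "finite F" "F \<subseteq> A"
  shows "sum f F \<le> infsum f A"
  unfolding infsum_ennreal_eq_SUP using assms by (intro SUP_upper) auto

lemma infsum_ennreal_mono_set:
  fixes f :: "'b \<Rightarrow> ennreal"
  assumes "A \<subseteq> B"
  shows "infsum f A \<le> infsum f B"
  unfolding infsum_ennreal_eq_SUP using assms by (intro SUP_subset_mono) auto

lemma infsum_ennreal_cmult:
  fixes f :: "'b \<Rightarrow> ennreal"
  shows "infsum (\<lambda>x. c * f x) A = c * infsum f A"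
  unfolding infsum_ennreal_eq_SUP
  by (simp add: SUP_mult_left_ennreal sum_distrib_left)

lemma infsum_UN_le_suminf:
  fixes f :: "'b \<Rightarrow> ennreal"
  shows "infsum f (\<Union>n::nat. A n) \<le> (\<Sum>n. infsum f (A n))"
  unfolding infsum_ennreal_eq_SUP[of f "\<Union>n. A n"]
proof (rule SUP_least, clarsimp)
  fix F assume F: "finite F" "F \<subseteq> (\<Union>n. A n)"
  then obtain N where N: "F \<subseteq> (\<Union>n<N. A n)"
  proof -
    have "\<forall>x\<in>F. \<exists>n. x \<in> A n" using F by auto
    then obtain g where g: "\<forall>x\<in>F. x \<in> A (g x)" by metis
    obtain N where "\<forall>n\<in>g ` F. n < N"
      using F(1) finite_nat_bounded[of "g ` F"] by auto
    with g have "F \<subseteq> (\<Union>n<N. A n)" by auto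
    then show ?thesis by (rule that)
  qed
  have *: "sum f (F \<inter> (\<Union>n<N. A n)) \<le> (\<Sum>n<N. sum f (F \<inter> A n))" for N
  proof (induction N)
    case (Suc N)
    have "F \<inter> (\<Union>n<Suc N. A n) = (F \<inter> (\<Union>n<N. A n)) \<union> (F \<inter> A N)"
      by (auto simp: less_Suc_eq)
    then have "sum f (F \<inter> (\<Union>n<Suc N. A n)) \<le> sum f (F \<inter> (\<Union>n<N. A n)) + sum f (F \<inter> A N)"
      using F(1) sum.union_inter[of "F \<inter> (\<Union>n<N. A n)" "F \<inter> A N" f]
      by (metis add_increasing2 finite_Int order_refl zero_le)
    also have "\<dots> \<le> (\<Sum>n<Suc N. sum f (F \<inter> A n))"
      using Suc by (simp add: add_right_mono)
    finally show ?case .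
  qed simp
  have "sum f F = sum f (F \<inter> (\<Union>n<N. A n))" using N by (simp add: Int_absorb2)
  also have "\<dots> \<le> (\<Sum>n<N. sum f (F \<inter> A n))" by (rule *)
  also have "\<dots> \<le> (\<Sum>n<N. infsum f (A n))"
    using F(1) by (intro sum_mono sum_le_infsum_ennreal) auto
  also have "\<dots> \<le> (\<Sum>n. infsum f (A n))"
    by (rule sum_le_suminf) auto
  finally show "sum f F \<le> (\<Sum>n. infsum f (A n))" .
qed

lemma emeasure_UN_le_infsum:
  assumes "countable I" and sets: "\<And>i. i \<in> I \<Longrightarrow> V i \<in> sets M"
  shows "emeasure M (\<Union>i\<in>I. V i) \<le> infsum (\<lambda>i. emeasure M (V i)) I"
proof (cases "finite I")
  case True
  then show ?thesis using emeasure_subadditive_finite[of I V M] sets by auto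
next
  case False
  with \<open>countable I\<close> have bij: "bij_betw (from_nat_into I) UNIV I"
    by (rule bij_betw_from_nat_into)
  let ?g = "from_nat_into I"
  have g: "range ?g = I" "inj ?g"
    using bij by (auto simp: bij_betw_def)
  have "(\<Union>i\<in>I. V i) = (\<Union>n. V (?g n))"
    by (subst g(1)[symmetric]) auto
  also have "emeasure M \<dots> \<le> (\<Sum>n. emeasure M (V (?g n)))"
    using sets g(1) by (intro emeasure_subadditive_countably) auto
  also have "\<dots> \<le> infsum (\<lambda>i. emeasure M (V i)) I"
  proof (rule suminf_le_const)
    fix N
    have "(\<Sum>n<N. emeasure M (V (?g n))) = (\<Sum>i\<in>?g ` {..<N}. emeasure M (V i))"
      using g(2) by (subst sum.reindex) (auto intro: inj_on_subset)
    also have "\<dots> \<le> infsum (\<lambda>i. emeasure M (V i)) I"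
      using g(1) by (intro sum_le_infsum_ennreal) auto
    finally show "(\<Sum>n<N. emeasure M (V (?g n))) \<le> infsum (\<lambda>i. emeasure M (V i)) I" .
  qed auto
  finally show ?thesis .
qed

section \<open>The Caratheodory construction is a metric outer measure\<close>

lemma cara_pre_mono:
  assumes "A \<subseteq> B"
  shows "cara_pre \<tau> \<delta> A \<le> cara_pre \<tau> \<delta> B"
  unfolding cara_pre_def using assms by (intro INF_superset_mono) (auto simp: covers_def)

lemma cara_pre_antimono:
  assumes "\<delta> \<le> \<epsilon>"
  shows "cara_pre \<tau> \<epsilon> A \<le> cara_pre \<tau> \<delta> A"
  unfolding cara_pre_def
  using assms by (intro INF_superset_mono) (auto simp: covers_def intro: order_trans ennreal_leI)

lemma cara_pre_le_outer:
  assumes "0 < \<delta>"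
  shows "cara_pre \<tau> \<delta> A \<le> cara_outer \<tau> A"
  unfolding cara_outer_def using assms by (intro SUP_upper) auto

lemma cara_outer_mono:
  assumes "A \<subseteq> B"
  shows "cara_outer \<tau> A \<le> cara_outer \<tau> B"
  unfolding cara_outer_def using assms by (intro SUP_mono) (auto intro: cara_pre_mono)

lemma cara_pre_le_infsum:
  assumes "\<U> \<in> covers \<delta> A"
  shows "cara_pre \<tau> \<delta> A \<le> infsum \<tau> \<U>"
  unfolding cara_pre_def using assms by (rule INF_lower)

lemma cara_outer_empty: "cara_outer \<tau> {} = 0"
proof -
  have "cara_pre \<tau> \<delta> {} \<le> 0" for \<delta>
    using cara_pre_le_infsum[of "{}" \<delta> "{}" \<tau>] by (simp add: covers_def)
  then show ?thesis
    unfolding cara_outer_def by (intro antisym SUP_least) auto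
qed

lemma cara_pre_countably_subadditive:
  "cara_pre \<tau> \<delta> (\<Union>n::nat. A n) \<le> (\<Sum>n. cara_pre \<tau> \<delta> (A n))"
proof (rule ennreal_le_epsilon)
  fix e :: real assume e: "0 < e" and fin: "(\<Sum>n. cara_pre \<tau> \<delta> (A n)) < top"
  have "\<exists>\<U>\<in>covers \<delta> (A n). infsum \<tau> \<U> < cara_pre \<tau> \<delta> (A n) + e * (1/2)^Suc n" for n
  proof -
    have "cara_pre \<tau> \<delta> (A n) < cara_pre \<tau> \<delta> (A n) + e * (1/2)^Suc n"
      using e fin by (auto simp: less_top dest!: ennreal_suminf_lessD)
    then show ?thesis
      unfolding cara_pre_def[of \<tau> \<delta> "A n"] INF_less_iff .
  qed
  then obtain \<U> where U: "\<And>n. \<U> n \<in> covers \<delta> (A n)"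
      "\<And>n. infsum \<tau> (\<U> n) \<le> cara_pre \<tau> \<delta> (A n) + e * (1/2)^Suc n"
    by (metis less_imp_le)
  have cov: "(\<Union>n. \<U> n) \<in> covers \<delta> (\<Union>n. A n)"
  proof -
    have "countable (\<Union>n. \<U> n)"
      using U(1) by (intro countable_UN) (auto simp: covers_def)
    moreover have "\<forall>U\<in>(\<Union>n. \<U> n). ediam U \<le> ennreal \<delta>"
      using U(1) by (auto simp: covers_def)
    moreover have "A n \<subseteq> \<Union>(\<Union>n. \<U> n)" for n
    proof -
      have "A n \<subseteq> \<Union>(\<U> n)"
        using U(1)[of n] by (simp add: covers_def)
      also have "\<dots> \<subseteq> \<Union>(\<Union>n. \<U> n)" by blast
      finally show ?thesis .
    qed
    ultimately show ?thesis
      unfolding covers_def mem_Collect_eq by (simp add: UN_least)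
  qed
  have "cara_pre \<tau> \<delta> (\<Union>n. A n) \<le> infsum \<tau> (\<Union>n. \<U> n)"
    using cov by (rule cara_pre_le_infsum)
  also have "\<dots> \<le> (\<Sum>n. infsum \<tau> (\<U> n))"
    by (rule infsum_UN_le_suminf)
  also have "\<dots> \<le> (\<Sum>n. cara_pre \<tau> \<delta> (A n) + e * (1/2) ^ Suc n)"
    by (intro suminf_le U allI) auto
  also have "\<dots> = (\<Sum>n. cara_pre \<tau> \<delta> (A n)) + (\<Sum>n. ennreal e * ennreal ((1/2) ^ Suc n))"
    using e by (subst suminf_add[symmetric])
      (auto simp del: ennreal_suminf_cmult simp add: ennreal_mult[symmetric])
  also have "\<dots> = (\<Sum>n. cara_pre \<tau> \<delta> (A n)) + e"
    unfolding ennreal_suminf_cmult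
    by (subst suminf_ennreal_eq[OF zero_le_power power_half_series]) auto
  finally show "cara_pre \<tau> \<delta> (\<Union>n. A n) \<le> (\<Sum>n. cara_pre \<tau> \<delta> (A n)) + e" .
qed

lemma cara_outer_measure_space: "outer_measure_space (Pow UNIV) (cara_outer \<tau>)"
  unfolding outer_measure_space_def
proof (intro conjI)
  show "positive (Pow UNIV) (cara_outer \<tau>)"
    by (simp add: positive_def cara_outer_empty)
  show "increasing (Pow UNIV) (cara_outer \<tau>)"
    by (simp add: increasing_def cara_outer_mono)
  show "countably_subadditive (Pow UNIV) (cara_outer \<tau>)"
    unfolding countably_subadditive_def
  proof (intro allI impI)
    fix A :: "nat \<Rightarrow> 'a set"
    show "cara_outer \<tau> (\<Union>i. A i) \<le> (\<Sum>i. cara_outer \<tau> (A i))"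
      unfolding cara_outer_def[of _ "\<Union>i. A i"]
    proof (rule SUP_least)
      fix \<delta> :: real assume "\<delta> \<in> {0<..}"
      then have "(\<Sum>n. cara_pre \<tau> \<delta> (A n)) \<le> (\<Sum>n. cara_outer \<tau> (A n))"
        by (intro suminf_le cara_pre_le_outer) auto
      then show "cara_pre \<tau> \<delta> (\<Union>i. A i) \<le> (\<Sum>i. cara_outer \<tau> (A i))"
        using cara_pre_countably_subadditive order_trans by blast
    qed
  qed
qed

lemma dist_le_ediam:
  assumes "x \<in> U" "y \<in> U"
  shows "ennreal (dist x y) \<le> ediam U"
  unfolding ediam_def using assms by (intro SUP_upper2[of "(x, y)"]) auto

text \<open>
  A set of diameter at most \<open>\<delta>\<close> cannot meet both \<open>A\<close> and \<open>B\<close>, so a cover of the union contains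
  disjoint subfamilies covering \<open>A\<close> and \<open>B\<close>.
\<close>
lemma cara_pre_separated:
  assumes sep: "\<And>a b. a \<in> A \<Longrightarrow> b \<in> B \<Longrightarrow> \<delta> < dist a b" and "0 \<le> \<delta>"
  shows "cara_pre \<tau> \<delta> A + cara_pre \<tau> \<delta> B \<le> cara_pre \<tau> \<delta> (A \<union> B)"
  unfolding cara_pre_def[of \<tau> \<delta> "A \<union> B"]
proof (rule INF_greatest)
  fix \<U> assume U: "\<U> \<in> covers \<delta> (A \<union> B)"
  define V where "V = (\<lambda>S. {U\<in>\<U>. U \<inter> S \<noteq> {}})"
  have disj: "V A \<inter> V B = {}"
  proof (rule ccontr)
    assume "V A \<inter> V B \<noteq> {}"
    then obtain W a b where W: "W \<in> \<U>" "a \<in> W" "a \<in> A" "b \<in> W" "b \<in> B"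
      by (auto simp: V_def)
    then have "ennreal (dist a b) \<le> ennreal \<delta>"
      using U dist_le_ediam[of a W b] by (auto simp: covers_def intro: order_trans)
    with sep[OF W(3,5)] \<open>0 \<le> \<delta>\<close> show False by simp
  qed
  have "V S \<in> covers \<delta> S" if "S \<subseteq> A \<union> B" for S
    using U that unfolding covers_def V_def by fastforce
  then have "cara_pre \<tau> \<delta> A + cara_pre \<tau> \<delta> B \<le> infsum \<tau> (V A) + infsum \<tau> (V B)"
    by (intro add_mono cara_pre_le_infsum) auto
  also have "\<dots> = infsum \<tau> (V A \<union> V B)"
    using disj by (intro infsum_Un_disjoint[symmetric] nonneg_summable_on_complete) auto
  also have "\<dots> \<le> infsum \<tau> \<U>"
    by (rule infsum_ennreal_mono_set) (auto simp: V_def)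
  finally show "cara_pre \<tau> \<delta> A + cara_pre \<tau> \<delta> B \<le> infsum \<tau> \<U>" .
qed

lemma cara_outer_separated:
  assumes e: "0 < e" and sep: "\<And>a b. a \<in> A \<Longrightarrow> b \<in> B \<Longrightarrow> e \<le> dist a b"
  shows "cara_outer \<tau> A + cara_outer \<tau> B \<le> cara_outer \<tau> (A \<union> B)"
proof -
  have le: "cara_pre \<tau> \<delta> A + cara_pre \<tau> \<epsilon> B \<le> cara_outer \<tau> (A \<union> B)" if "0 < \<delta>" "0 < \<epsilon>" for \<delta> \<epsilon>
  proof -
    define \<eta> where "\<eta> = min (e / 2) (min \<delta> \<epsilon>)"
    have \<eta>: "0 < \<eta>" "\<eta> < e" "\<eta> \<le> \<delta>" "\<eta> \<le> \<epsilon>" using that e by (auto simp: \<eta>_def)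
    have "cara_pre \<tau> \<delta> A + cara_pre \<tau> \<epsilon> B \<le> cara_pre \<tau> \<eta> A + cara_pre \<tau> \<eta> B"
      using \<eta> by (intro add_mono cara_pre_antimono)
    also have "\<dots> \<le> cara_pre \<tau> \<eta> (A \<union> B)"
    proof (rule cara_pre_separated)
      show "\<eta> < dist a b" if "a \<in> A" "b \<in> B" for a b
        using sep[OF that] \<eta> by linarith
    qed (use \<eta> in auto)
    also have "\<dots> \<le> cara_outer \<tau> (A \<union> B)"
      using \<eta> by (intro cara_pre_le_outer)
    finally show ?thesis .
  qed
  have ne: "{0::real<..} \<noteq> {}" by auto
  have "cara_outer \<tau> A + cara_outer \<tau> B =
      (SUP \<delta>\<in>{0<..}. SUP \<epsilon>\<in>{0<..}. cara_pre \<tau> \<delta> A + cara_pre \<tau> \<epsilon> B)"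
    unfolding cara_outer_def
    unfolding ennreal_SUP_add_left[OF ne, symmetric]
    by (subst ennreal_SUP_add_right[OF ne]) simp
  also have "\<dots> \<le> cara_outer \<tau> (A \<union> B)"
    using le by (intro SUP_least) auto
  finally show ?thesis .
qed

section \<open>Caratheodory's criterion\<close>

lemma outer_measure_space_Un_le:
  assumes "outer_measure_space (Pow UNIV) f"
  shows "f (A \<union> B) \<le> f A + f B"
proof -
  interpret algebra UNIV "Pow UNIV" by (rule algebra_Pow)
  have "subadditive (Pow UNIV) f" and inc: "increasing (Pow UNIV) f"
    using assms countably_subadditive_subadditive by (auto simp: outer_measure_space_def)
  then have "f (A \<union> (B - A)) \<le> f A + f (B - A)"
    by (intro subadditiveD) auto
  also have "f (B - A) \<le> f B"
    using inc by (rule increasingD) auto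
  finally show ?thesis by (simp add: add_left_mono)
qed

lemma outer_measure_space_UN_le:
  assumes "outer_measure_space (Pow UNIV) f"
  shows "f (\<Union>n::nat. A n) \<le> (\<Sum>n. f (A n))"
proof -
  have "f (\<Union>n. A n) = f (\<Union>n. disjointed A n)"
    by (simp add: UN_disjointed_eq)
  also have "\<dots> \<le> (\<Sum>n. f (disjointed A n))"
    using assms disjoint_family_disjointed[of A]
    by (auto simp: outer_measure_space_def countably_subadditive_def)
  also have "\<dots> \<le> (\<Sum>n. f (A n))"
    using assms disjointed_subset[of A]
    by (intro suminf_le) (auto simp: outer_measure_space_def increasing_def)
  finally show ?thesis .
qed

lemma suminf_tail_small_ennreal:
  fixes f :: "nat \<Rightarrow> ennreal"
  assumes "(\<Sum>n. f n) < top" "0 < e"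
  shows "\<exists>n. (\<Sum>k. f (k + n)) \<le> ennreal e"
proof -
  define g where "g = (\<lambda>n. enn2real (f n))"
  have fin: "f n < top" for n
    using assms(1) by (auto simp: less_top dest!: ennreal_suminf_lessD)
  have fg: "f n = ennreal (g n)" and g0: "0 \<le> g n" for n
    using fin[of n] by (auto simp: g_def less_top)
  have "summable g"
    using assms(1) g0 by (intro summable_suminf_not_top) (auto simp: fg less_top)
  then obtain n where "norm (\<Sum>k. g (k + n)) < e"
    using suminf_exist_split[OF assms(2), of g] by auto
  moreover have "(\<Sum>k. f (k + n)) = ennreal (\<Sum>k. g (k + n))"
    unfolding fg using \<open>summable g\<close> g0 by (intro suminf_ennreal2) (auto simp: summable_iff_shift)
  ultimately show ?thesis
    by (intro exI[of _ n]) (auto intro!: ennreal_leI)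
qed

text \<open>
  Measurability of a closed set \<open>F\<close>. The part \<open>G n\<close> of \<open>A\<close> at distance at least \<open>1 / (n + 1)\<close>
  from \<open>F\<close> is separated from \<open>A \<inter> F\<close>, so the inequality holds with \<open>G n\<close> in place of \<open>A - F\<close>.
  What is left of \<open>A - F\<close> is a union of shells \<open>R k\<close> with \<open>k \<ge> n\<close>. Every other shell is
  separated from the preceding ones, so the values \<open>f (R k)\<close> have finite sum and the tail is negligible.
\<close>
lemma metric_outer_measure_closed:
  fixes f :: "'a::metric_space set \<Rightarrow> ennreal"
  assumes oms: "outer_measure_space (Pow UNIV) f"
    and metric: "\<And>A B e. 0 < e \<Longrightarrow> (\<And>a b. a \<in> A \<Longrightarrow> b \<in> B \<Longrightarrow> e \<le> dist a b) \<Longrightarrow>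
      f A + f B \<le> f (A \<union> B)"
    and F: "closed F"
  shows "f (A \<inter> F) + f (A - F) \<le> f A"
proof (cases "F = {} \<or> f A = top")
  case True
  then show ?thesis using oms by (auto simp: outer_measure_space_def positive_def)
next
  case False
  then have ne: "F \<noteq> {}" and fin: "f A < top" by (auto simp: less_top)
  have mono: "f S \<le> f T" if "S \<subseteq> T" for S T
    using oms that by (auto simp: outer_measure_space_def increasing_def)
  define r where "r = (\<lambda>n. inverse (real (Suc n)))"
  have r_pos: "0 < r n" for n by (simp add: r_def)
  have r_less: "r m < r n" if "n < m" for m n using that by (simp add: r_def)
  define G where "G = (\<lambda>n. {x\<in>A. r n \<le> infdist x F})"
  define R where "R = (\<lambda>n. {x\<in>A. r (Suc n) \<le> infdist x F \<and> infdist x F < r n})"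
  have sep_dist: "s - t \<le> dist a b" if "s \<le> infdist a F" "infdist b F < t" for a b s t
    using that infdist_triangle[of a F b] by (auto simp: dist_commute)
  have AG: "f (A \<inter> F) + f (G n) \<le> f A" for n
  proof -
    have "f (A \<inter> F) + f (G n) \<le> f (A \<inter> F \<union> G n)"
    proof (rule metric[OF r_pos])
      show "r n \<le> dist a b" if "a \<in> A \<inter> F" "b \<in> G n" for a b
        using that infdist_le[of a F b] by (auto simp: G_def dist_commute)
    qed
    also have "\<dots> \<le> f A" by (rule mono) (auto simp: G_def)
    finally show ?thesis .
  qed
  \<comment> \<open>Between shells whose indices differ by two lies a whole shell, which keeps them apart; hence
    the even and the odd shells are treated separately.\<close>
  have parity: "(\<Sum>k<N. f (R (2 * k + p))) \<le> f A" for N p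
  proof -
    have "(\<Sum>k<N. f (R (2 * k + p))) \<le> f (\<Union>k<N. R (2 * k + p))"
    proof (induction N)
      case (Suc N)
      let ?U = "\<Union>k<N. R (2 * k + p)"
      have "(\<Sum>k<Suc N. f (R (2 * k + p))) \<le> f ?U + f (R (2 * N + p))"
        using Suc by (simp add: add_right_mono)
      also have "\<dots> \<le> f (?U \<union> R (2 * N + p))"
      proof (cases "N = 0")
        case True
        then show ?thesis using oms by (simp add: outer_measure_space_def positive_def)
      next
        case False
        let ?s = "r (2 * N + p - 1)" and ?t = "r (2 * N + p)"
        have "0 < ?s - ?t" using r_less[of "2 * N + p - 1" "2 * N + p"] False by simp
        then show ?thesis
        proof (rule metric)
          fix a b assume "a \<in> ?U" "b \<in> R (2 * N + p)"
          then obtain k where k: "k < N" "r (Suc (2 * k + p)) \<le> infdist a F" "infdist b F < ?t"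
            by (auto simp: R_def)
          have "?s \<le> r (Suc (2 * k + p))"
          proof (cases "Suc (2 * k + p) = 2 * N + p - 1")
            case False
            then show ?thesis using k(1) by (intro less_imp_le r_less) auto
          qed simp
          then show "?s - ?t \<le> dist a b" using k by (intro sep_dist) auto
        qed
      qed
      also have "?U \<union> R (2 * N + p) = (\<Union>k<Suc N. R (2 * k + p))"
        by (auto simp: less_Suc_eq)
      finally show ?case .
    qed simp
    also have "\<dots> \<le> f A" by (rule mono) (auto simp: R_def)
    finally show ?thesis .
  qed
  have "(\<Sum>k. f (R k)) \<le> f A + f A"
  proof (rule suminf_le_const)
    fix N
    have "(\<Sum>k<N. f (R k)) \<le> (\<Sum>k<2 * N. f (R k))"
      by (rule sum_mono2) auto
    also have "(\<Sum>k<2 * N. f (R k)) = (\<Sum>k<N. f (R (2 * k + 0))) + (\<Sum>k<N. f (R (2 * k + 1)))"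
      by (induction N) (auto simp: algebra_simps)
    also have "\<dots> \<le> f A + f A" by (intro add_mono parity)
    finally show "(\<Sum>k<N. f (R k)) \<le> f A + f A" .
  qed auto
  also have "\<dots> < top" using fin by simp
  finally have R_fin: "(\<Sum>k. f (R k)) < top" .
  show ?thesis
  proof (rule ennreal_le_epsilon)
    fix e :: real assume "0 < e"
    then obtain n where n: "(\<Sum>k. f (R (k + n))) \<le> ennreal e"
      using suminf_tail_small_ennreal[OF R_fin] by blast
    have "A - F \<subseteq> G n \<union> (\<Union>k. R (k + n))"
    proof
      fix x assume x: "x \<in> A - F"
      show "x \<in> G n \<union> (\<Union>k. R (k + n))"
      proof (cases "r n \<le> infdist x F")
        case False
        have "0 < infdist x F"
          using x F ne by (intro infdist_pos_not_in_closed) auto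
        then obtain m where "r m < infdist x F"
          unfolding r_def using reals_Archimedean by blast
        then have ex: "\<exists>m. r m \<le> infdist x F" by (auto intro: less_imp_le)
        define m where "m = (LEAST m. r m \<le> infdist x F)"
        have m: "r m \<le> infdist x F" unfolding m_def using ex by (rule LeastI_ex)
        have "n < m"
        proof (rule ccontr)
          assume "\<not> n < m"
          then have "r n \<le> r m" by (simp add: r_def)
          with m False show False by simp
        qed
        then have "infdist x F < r (m - 1)"
          using not_less_Least[of "m - 1" "\<lambda>m. r m \<le> infdist x F"] by (simp add: m_def[symmetric])
        with m x \<open>n < m\<close> have "x \<in> R (m - 1 - n + n)" by (simp add: R_def)
        then show ?thesis by blast
      qed (use x in \<open>simp add: G_def\<close>)
    qed
    then have "f (A - F) \<le> f (G n \<union> (\<Union>k. R (k + n)))" by (rule mono)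
    also have "\<dots> \<le> f (G n) + f (\<Union>k. R (k + n))"
      using oms by (rule outer_measure_space_Un_le)
    also have "\<dots> \<le> f (G n) + ennreal e"
      using outer_measure_space_UN_le[OF oms, of "\<lambda>k. R (k + n)"] n by (intro add_left_mono) (rule order_trans)
    finally have "f (A \<inter> F) + f (A - F) \<le> f (A \<inter> F) + (f (G n) + ennreal e)"
      by (rule add_left_mono)
    also have "\<dots> \<le> f A + ennreal e"
      using AG[of n] by (simp add: add.assoc[symmetric] add_right_mono)
    finally show "f (A \<inter> F) + f (A - F) \<le> f A + ennreal e" .
  qed
qed

lemma borel_subset_lambda_system:
  fixes f :: "'a::metric_space set \<Rightarrow> ennreal"
  assumes oms: "outer_measure_space (Pow UNIV) f"
    and metric: "\<And>A B e. 0 < e \<Longrightarrow> (\<And>a b. a \<in> A \<Longrightarrow> b \<in> B \<Longrightarrow> e \<le> dist a b) \<Longrightarrow>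
      f A + f B \<le> f (A \<union> B)"
  shows "sets borel \<subseteq> lambda_system UNIV (Pow UNIV) f"
proof -
  interpret sigma_algebra UNIV "Pow UNIV :: 'a set set" by (rule sigma_algebra_Pow)
  have "closed F \<Longrightarrow> F \<in> lambda_system UNIV (Pow UNIV) f" for F
  proof -
    assume F: "closed F"
    have "f (A \<inter> F) + f (A - F) = f A" for A
    proof (rule antisym)
      show "f (A \<inter> F) + f (A - F) \<le> f A"
        using oms metric F by (rule metric_outer_measure_closed)
      show "f A \<le> f (A \<inter> F) + f (A - F)"
        using outer_measure_space_Un_le[OF oms, of "A \<inter> F" "A - F"] by (simp add: Int_Diff_Un)
    qed
    then show "F \<in> lambda_system UNIV (Pow UNIV) f"
      unfolding lambda_system_eq by auto
  qed
  moreover have "sigma_algebra UNIV (lambda_system UNIV (Pow UNIV) f)"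
    using caratheodory_lemma[OF oms] by (simp add: measure_space_def)
  ultimately have "sigma_sets UNIV (Collect closed) \<subseteq> lambda_system UNIV (Pow UNIV) f"
    by (intro sigma_algebra.sigma_sets_subset) (auto simp del: Pow_UNIV)
  moreover have "sets borel = sigma_sets UNIV (Collect closed :: 'a set set)"
    by (simp add: borel_eq_closed)
  ultimately show ?thesis by (simp only:)
qed

lemma emeasure_cara_measure:
  assumes "E \<in> sets borel"
  shows "emeasure (cara_measure \<tau>) E = cara_outer \<tau> E"
proof -
  interpret sigma_algebra UNIV "Pow UNIV :: 'a set set" by (rule sigma_algebra_Pow)
  have "sets borel \<subseteq> lambda_system UNIV (Pow UNIV) (cara_outer \<tau>)"
    using cara_outer_measure_space cara_outer_separated by (rule borel_subset_lambda_system)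
  moreover have "measure_space UNIV (lambda_system UNIV (Pow UNIV) (cara_outer \<tau>)) (cara_outer \<tau>)"
    using cara_outer_measure_space by (rule caratheodory_lemma)
  ultimately have "countably_additive (sets borel) (cara_outer \<tau>)" "positive (sets borel) (cara_outer \<tau>)"
    unfolding measure_space_def positive_def countably_additive_def
    by (auto simp: subset_iff)
  then show ?thesis
    unfolding cara_measure_def using assms sets.sigma_algebra_axioms[of borel]
    by (intro emeasure_measure_of_sigma) simp_all
qed

lemma sets_cara_measure: "sets (cara_measure \<tau>) = sets borel"
  unfolding cara_measure_def using sets.sigma_sets_eq[of borel] by simp

section \<open>The mass distribution principle\<close>

text \<open>
  Replacing each member of a cover that meets \<open>A\<close> by its measurable hull \<open>V\<close> bounds the measure of \<open>A\<close>
  by the sum of the cover. The hull is what allows covers by non-measurable sets.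
\<close>
lemma emeasure_le_cara_outer:
  fixes \<nu> :: "'a::metric_space measure"
  assumes "0 < \<delta>" and L: "0 < L" "L < top"
    and bound: "\<And>U. U \<inter> A \<noteq> {} \<Longrightarrow> ediam U \<le> ennreal \<delta> \<Longrightarrow>
      \<exists>V\<in>sets \<nu>. U \<subseteq> V \<and> emeasure \<nu> V \<le> L * \<tau> U"
  shows "emeasure \<nu> A \<le> L * cara_outer \<tau> A"
proof -
  have "emeasure \<nu> A \<le> L * infsum \<tau> \<U>" if U: "\<U> \<in> covers \<delta> A" for \<U>
  proof -
    define \<W> where "\<W> = {U\<in>\<U>. U \<inter> A \<noteq> {}}"
    have "\<forall>U\<in>\<W>. \<exists>V\<in>sets \<nu>. U \<subseteq> V \<and> emeasure \<nu> V \<le> L * \<tau> U"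
      using U bound by (auto simp: \<W>_def covers_def)
    then obtain V where V: "\<And>U. U \<in> \<W> \<Longrightarrow> V U \<in> sets \<nu>" "\<And>U. U \<in> \<W> \<Longrightarrow> U \<subseteq> V U"
        "\<And>U. U \<in> \<W> \<Longrightarrow> emeasure \<nu> (V U) \<le> L * \<tau> U"
      by metis
    have count: "countable \<W>"
      using U by (auto simp: \<W>_def covers_def)
    have "A \<subseteq> \<Union>\<W>"
      using U unfolding \<W>_def covers_def by blast
    then have "A \<subseteq> (\<Union>U\<in>\<W>. V U)"
      using V(2) by blast
    then have "emeasure \<nu> A \<le> emeasure \<nu> (\<Union>U\<in>\<W>. V U)"
      using count V(1) by (intro emeasure_mono sets.countable_UN') auto
    also have "\<dots> \<le> infsum (\<lambda>U. emeasure \<nu> (V U)) \<W>"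
      using count V(1) by (rule emeasure_UN_le_infsum)
    also have "\<dots> \<le> infsum (\<lambda>U. L * \<tau> U) \<W>"
      using V(3) by (intro infsum_mono nonneg_summable_on_complete) auto
    also have "\<dots> \<le> L * infsum \<tau> \<U>"
      unfolding infsum_ennreal_cmult
      by (intro mult_left_mono infsum_ennreal_mono_set) (auto simp: \<W>_def)
    finally show ?thesis .
  qed
  then have "emeasure \<nu> A / L \<le> infsum \<tau> \<U>" if "\<U> \<in> covers \<delta> A" for \<U>
    using that L by (intro divide_le_posI_ennreal) (auto simp: mult.commute)
  then have "emeasure \<nu> A / L \<le> cara_pre \<tau> \<delta> A"
    unfolding cara_pre_def by (rule INF_greatest)
  also have "\<dots> \<le> cara_outer \<tau> A"
    using \<open>0 < \<delta>\<close> by (rule cara_pre_le_outer)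
  finally have "L * (emeasure \<nu> A / L) \<le> L * cara_outer \<tau> A"
    by (rule mult_left_mono) simp
  then show ?thesis
    using L by (simp add: ennreal_times_divide mult.commute[of L] ennreal_mult_divide_eq)
qed

section \<open>Closed sets determine finite Borel measures\<close>

text \<open>
  The sets that can be approximated form a sigma-algebra; it contains every closed set, since
  a closed set is the intersection of its open neighbourhoods of radius \<open>1 / (n + 1)\<close>.
\<close>
lemma finite_borel_measure_closed_open_approx:
  fixes M :: "'a::metric_space measure"
  assumes "finite_measure M" and sets: "sets M = sets borel"
    and "E \<in> sets borel"
  shows "\<forall>e>0. \<exists>F G. closed F \<and> open G \<and> F \<subseteq> E \<and> E \<subseteq> G \<and> measure M (G - F) < e"
proof -
  interpret finite_measure M by fact
  have [simp]: "open S \<Longrightarrow> S \<in> sets M" "closed S \<Longrightarrow> S \<in> sets M" for S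
    by (auto simp: sets)
  have "E \<in> sigma_sets UNIV (Collect closed)"
    using assms(3) unfolding borel_eq_closed by simp
  then show ?thesis
  proof induction
    case (Basic F)
    then have F: "closed F" by simp
    show ?case
    proof (intro allI impI)
      fix e :: real assume "0 < e"
      show "\<exists>F' G. closed F' \<and> open G \<and> F' \<subseteq> F \<and> F \<subseteq> G \<and> measure M (G - F') < e"
      proof (cases "F = {}")
        case True
        then show ?thesis using \<open>0 < e\<close> by (intro exI[of _ "{}"]) simp
      next
        case False
        define G where "G = (\<lambda>n. {x. infdist x F < inverse (real (Suc n))})"
        have G: "open (G n)" for n
          unfolding G_def by (intro open_Collect_less continuous_intros)
        have "(\<Inter>n. G n - F) = {}"
        proof -
          have "\<exists>n. x \<notin> G n" if "x \<notin> F" for x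
          proof -
            have "0 < infdist x F" using F False that by (intro infdist_pos_not_in_closed)
            then obtain n where "inverse (real (Suc n)) < infdist x F"
              using reals_Archimedean by blast
            then show ?thesis by (auto simp: G_def intro!: exI[of _ n])
          qed
          then show ?thesis by auto
        qed
        moreover have "(\<lambda>n. measure M (G n - F)) \<longlonglongrightarrow> measure M (\<Inter>n. G n - F)"
        proof (rule finite_Lim_measure_decseq)
          show "range (\<lambda>n. G n - F) \<subseteq> sets M" using G F by auto
          have "G n \<subseteq> G m" if "m \<le> n" for m n
          proof -
            have "inverse (real (Suc n)) \<le> inverse (real (Suc m))" using that by simp
            then show ?thesis unfolding G_def by (auto intro: less_le_trans)
          qed
          then show "decseq (\<lambda>n. G n - F)" unfolding decseq_def by blast
        qed
        ultimately have "(\<lambda>n. measure M (G n - F)) \<longlonglongrightarrow> 0" by (metis measure_empty)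
        then have "\<forall>\<^sub>F n in sequentially. measure M (G n - F) < e"
          using \<open>0 < e\<close> by (rule order_tendstoD)
        then obtain n where "measure M (G n - F) < e"
          by (auto simp: eventually_sequentially)
        moreover have "F \<subseteq> G n" by (auto simp: G_def)
        ultimately show ?thesis using F G by blast
      qed
    qed
  next
    case Empty
    have "closed {} \<and> open {} \<and> {} \<subseteq> {} \<and> {} \<subseteq> {} \<and> measure M ({} - {}) < e" if "0 < e" for e
      using that by simp
    then show ?case by blast
  next
    case (Compl E)
    show ?case
    proof (intro allI impI)
      fix e :: real assume "0 < e"
      then obtain F G where FG: "closed F" "open G" "F \<subseteq> E" "E \<subseteq> G" "measure M (G - F) < e"
        using Compl.IH by meson
      have "- F - - G = G - F" by auto
      with FG show "\<exists>F G. closed F \<and> open G \<and> F \<subseteq> UNIV - E \<and> UNIV - E \<subseteq> G \<and> measure M (G - F) < e"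
        by (intro exI[of _ "- G"] exI[of _ "- F"] conjI) auto
    qed
  next
    case (Union E)
    show ?case
    proof (intro allI impI)
      fix e :: real assume e: "0 < e"
      define d where "d = (\<lambda>n. e / 2 * (1/2)^Suc n)"
      have d: "0 < d n" for n using e by (simp add: d_def)
      have d_sums: "d sums (e / 2)"
        unfolding d_def using sums_mult[OF power_half_series, of "e / 2"] by simp
      have "\<forall>n. \<exists>F G. closed F \<and> open G \<and> F \<subseteq> E n \<and> E n \<subseteq> G \<and> measure M (G - F) < d n"
        using Union.IH d by simp
      then obtain F G where FG: "\<And>n. closed (F n)" "\<And>n. open (G n)" "\<And>n. F n \<subseteq> E n"
          "\<And>n. E n \<subseteq> G n" "\<And>n. measure M (G n - F n) < d n"
        by metis
      let ?G = "\<Union>n. G n" and ?F = "\<lambda>N. \<Union>n<N. F n"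
      \<comment> \<open>Infinitely many \<open>F n\<close> need not have a closed union, so half of the error is reserved for
        cutting off all but finitely many of them.\<close>
      have small: "measure M (G n - F n) \<le> d n" for n
        using FG(5) by (rule less_imp_le)
      have summ: "summable (\<lambda>n. measure M (G n - F n))"
        using sums_summable[OF d_sums]
        by (rule summable_comparison_test') (use small in simp)
      have "measure M (?G - (\<Union>n. F n)) \<le> measure M (\<Union>n. G n - F n)"
        using FG by (intro finite_measure_mono sets.countable_UN) auto
      also have "\<dots> \<le> (\<Sum>n. measure M (G n - F n))"
        using FG(1,2) summ by (intro finite_measure_subadditive_countably) auto
      also have "\<dots> \<le> e / 2"
        unfolding sums_unique[OF d_sums]
        using small summ sums_summable[OF d_sums] by (rule suminf_le)
      finally have le: "measure M (?G - (\<Union>n. F n)) \<le> e / 2" .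
      have "(\<lambda>N. measure M (?G - ?F N)) \<longlonglongrightarrow> measure M (\<Inter>N. ?G - ?F N)"
        using FG by (intro finite_Lim_measure_decseq)
          (auto simp: decseq_def intro!: sets.Diff open_UN closed_UN)
      also have "(\<Inter>N. ?G - ?F N) = ?G - (\<Union>n. F n)" by auto
      finally have "\<forall>\<^sub>F N in sequentially. measure M (?G - ?F N) < e"
        by (rule order_tendstoD) (use le e in simp)
      then obtain N where "measure M (?G - ?F N) < e"
        by (auto simp: eventually_sequentially)
      moreover have "closed (?F N)" "open ?G" using FG(1,2) by (auto intro: closed_UN)
      moreover have "?F N \<subseteq> (\<Union>n. E n)" "(\<Union>n. E n) \<subseteq> ?G"
        using FG(3,4) by (meson UN_mono UNIV_I subset_UNIV)+
      ultimately show "\<exists>F G. closed F \<and> open G \<and> F \<subseteq> (\<Union>n. E n) \<and> (\<Union>n. E n) \<subseteq> G \<and> measure M (G - F) < e"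
        by (intro exI conjI)
    qed
  qed
qed

lemma emeasure_le_of_closed:
  fixes M N :: "'a::metric_space measure"
  assumes "finite_measure M" "sets M = sets borel" "sets N = sets borel"
    and closed: "\<And>F. closed F \<Longrightarrow> emeasure M F \<le> L * emeasure N F"
    and E: "E \<in> sets borel"
  shows "emeasure M E \<le> L * emeasure N E"
proof (rule ennreal_le_epsilon)
  interpret finite_measure M by fact
  fix e :: real assume "0 < e"
  then obtain F G where FG: "closed F" "open G" "F \<subseteq> E" "E \<subseteq> G" "measure M (G - F) < e"
    using finite_borel_measure_closed_open_approx[OF assms(1,2) E] by meson
  have in_sets: "F \<in> sets M" "G \<in> sets M" "F \<in> sets N" "E \<in> sets M" "E \<in> sets N"
    using FG assms by auto
  have "emeasure M E \<le> emeasure M (F \<union> (G - F))"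
    using FG in_sets by (intro emeasure_mono) auto
  also have "\<dots> \<le> emeasure M F + emeasure M (G - F)"
    using in_sets by (intro emeasure_subadditive) auto
  also have "\<dots> \<le> L * emeasure N F + ennreal e"
    using FG closed by (intro add_mono) (auto simp: emeasure_eq_measure intro: ennreal_leI)
  also have "\<dots> \<le> L * emeasure N E + ennreal e"
    using FG in_sets by (intro add_mono mult_left_mono emeasure_mono) auto
  finally show "emeasure M E \<le> L * emeasure N E + ennreal e" .
qed

section \<open>Separated nets in compact spaces\<close>

text \<open>
  A \<open>2 * r\<close>-separated set has at most as many points as a cover of the space by balls of
  radius \<open>r\<close>, because no such ball contains two of them. So there is one of largest cardinality, and
  it cannot be enlarged.
\<close>
lemma obtain_separated_net:
  fixes A :: "'a::metric_space set"
  assumes "compact (UNIV :: 'a set)" "0 < r"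
  obtains S where "finite S" "S \<subseteq> A" "A \<subseteq> (\<Union>x\<in>S. ball x (2 * r))"
    "disjoint_family_on (\<lambda>x. ball x r) S"
proof -
  have "\<exists>T. finite T \<and> (UNIV :: 'a set) \<subseteq> (\<Union>t\<in>T. ball t r)"
    using assms(1)[unfolded compact_eq_totally_bounded] assms(2) by simp
  then obtain T where T: "finite T" "(UNIV :: 'a set) \<subseteq> (\<Union>t\<in>T. ball t r)"
    by (elim exE conjE)
  define P where "P = (\<lambda>S. finite S \<and> S \<subseteq> A \<and> (\<forall>x\<in>S. \<forall>y\<in>S. x \<noteq> y \<longrightarrow> 2 * r \<le> dist x y))"
  have card: "card S \<le> card T" if "P S" for S
  proof -
    have "\<forall>x. \<exists>t. t \<in> T \<and> dist t x < r" using T(2) by (auto simp: subset_eq Bex_def)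
    then obtain g where "\<forall>x. g x \<in> T \<and> dist (g x) x < r" by (rule choice[THEN exE])
    then have g: "\<And>x. g x \<in> T" "\<And>x. dist (g x) x < r" by auto
    have "inj_on g S"
    proof (rule inj_onI, rule ccontr)
      fix x y assume "x \<in> S" "y \<in> S" "g x = g y" "x \<noteq> y"
      then have "2 * r \<le> dist x y" using that by (auto simp: P_def)
      moreover have "dist x y \<le> dist (g x) x + dist (g x) y" by (rule dist_triangle3)
      ultimately show False using g(2)[of x] g(2)[of y] \<open>g x = g y\<close> by simp
    qed
    then show ?thesis using g(1) T(1) by (intro card_inj_on_le[of g]) auto
  qed
  have "P {}" by (simp add: P_def)
  then obtain S where S: "P S" "\<And>S'. P S' \<Longrightarrow> card S' \<le> card S"
    using ex_has_greatest_nat[of P "{}" card "Suc (card T)"] card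
    by (metis le_imp_less_Suc)
  show ?thesis
  proof
    show "finite S" "S \<subseteq> A" using S by (auto simp: P_def)
    show "A \<subseteq> (\<Union>x\<in>S. ball x (2 * r))"
    proof (rule ccontr)
      assume "\<not> ?thesis"
      then obtain a where a: "a \<in> A" "\<And>x. x \<in> S \<Longrightarrow> 2 * r \<le> dist x a"
        by (force simp: not_less)
      have "a \<notin> S" using a(2)[of a] assms(2) by auto
      have "P (insert a S)" using S(1) a by (auto simp: P_def dist_commute)
      then have "card (insert a S) \<le> card S" by (rule S(2))
      with \<open>a \<notin> S\<close> S(1) show False by (simp add: P_def)
    qed
    show "disjoint_family_on (\<lambda>x. ball x r) S"
      unfolding disjoint_family_on_def
    proof (intro ballI impI, rule ccontr)
      fix x y assume "x \<in> S" "y \<in> S" "x \<noteq> y" "ball x r \<inter> ball y r \<noteq> {}"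
      then obtain z where "dist x z < r" "dist y z < r" by auto
      moreover have "dist x y \<le> dist x z + dist y z" by (rule dist_triangle2)
      moreover have "2 * r \<le> dist x y"
        using S(1) \<open>x \<in> S\<close> \<open>y \<in> S\<close> \<open>x \<noteq> y\<close> by (auto simp: P_def)
      ultimately show False by simp
    qed
  qed
qed

section \<open>Powers of diameters\<close>

text \<open>
  The exponent \<open>b\<close> may be negative, in which case the right-hand side is at least 1. This
  matters for balls centred where \<open>Q\<close> is smaller than its oscillation.
\<close>
lemma epow_le_powr:
  assumes "t \<le> ennreal u" "0 < u" "u \<le> 1" "ennreal b \<le> a"
  shows "epow t a \<le> ennreal (u powr b)"
proof -
  have t: "t = ennreal (enn2real t)" "enn2real t \<le> u"
  proof -
    have "t < top" using assms(1) ennreal_less_top by (rule le_less_trans)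
    then show "t = ennreal (enn2real t)" by simp
    show "enn2real t \<le> u" using assms(1,2) by (simp add: enn2real_leI)
  qed
  consider "a = 0" | "a = \<infinity>" | "a \<noteq> 0" "a \<noteq> \<infinity>" by blast
  then show ?thesis
  proof cases
    case 1
    then have "b \<le> 0" using assms(4) by (simp add: ennreal_eq_0_iff)
    then have "u powr 0 \<le> u powr b" using assms by (intro powr_mono') auto
    then show ?thesis using 1 assms(2) by (simp add: epow_def)
  next
    case 2
    have "t < 1 \<or> u = 1 \<and> t = 1"
    proof (cases "t < 1")
      case False
      then have "1 \<le> ennreal u" using assms(1) by (meson not_less order_trans)
      then have "u = 1" using assms by simp
      then show ?thesis using assms(1) False by (auto simp: not_less)
    qed simp
    then show ?thesis using 2 by (auto simp: epow_def)
  next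
    case 3
    then have a: "0 < enn2real a" "b \<le> enn2real a" 
    proof -
      have fin: "a < top" using 3 by (simp add: less_top)
      then show "0 < enn2real a" using 3 by (simp add: enn2real_positive_iff zero_less_iff_neq_zero)
      have "ennreal b \<le> ennreal (enn2real a)" using assms(4) fin by simp
      then show "b \<le> enn2real a" using \<open>0 < enn2real a\<close> by (cases "b \<le> 0") auto
    qed
    have "enn2real t powr enn2real a \<le> u powr enn2real a"
      using t(2) a(1) by (intro powr_mono2) auto
    also have "\<dots> \<le> u powr b" using assms(2,3) a(2) by (intro powr_mono') auto
    finally show ?thesis using 3 t(1) by (auto simp: epow_def intro!: ennreal_leI)
  qed
qed

lemma powr_le_epow:
  assumes "0 < u" "u \<le> 1" "a \<le> ennreal b" "0 \<le> b"
  shows "ennreal (u powr b) \<le> epow (ennreal u) a"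
proof (cases "a = 0")
  case True
  have "u powr b \<le> u powr 0" using assms by (intro powr_mono') auto
  then show ?thesis using True assms(1) by (simp add: epow_def)
next
  case False
  have fin: "a \<noteq> \<infinity>" using assms(3) by (auto simp: top_unique)
  have "enn2real a \<le> b" using assms(3,4) by (simp add: enn2real_leI)
  then have "u powr b \<le> u powr enn2real a" using assms by (intro powr_mono') auto
  then show ?thesis using False fin assms(1) by (auto simp: epow_def intro!: ennreal_leI)
qed

lemma ediam_ball_le: "0 \<le> r \<Longrightarrow> ediam (ball x r) \<le> ennreal (2 * r)"
  unfolding ediam_def
proof (intro SUP_least ennreal_leI)
  fix p assume "p \<in> ball x r \<times> ball x r"
  then show "dist (fst p) (snd p) \<le> 2 * r"
    using dist_triangle3[of "fst p" "snd p" x] by auto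
qed

lemma ex_small_powr:
  fixes a B e \<rho> :: real
  assumes "0 < a" "0 \<le> B" "0 < e" "0 < \<rho>"
  shows "\<exists>r. 0 < r \<and> r \<le> \<rho> \<and> B * r powr a \<le> e"
proof -
  define r where "r = min \<rho> ((e / (B + 1)) powr (1 / a))"
  have r: "0 < r" "r \<le> \<rho>" using assms by (auto simp: r_def)
  have "r powr a \<le> ((e / (B + 1)) powr (1 / a)) powr a"
    using r(1) assms by (intro powr_mono2) (auto simp: r_def)
  also have "\<dots> = e / (B + 1)" using assms by (simp add: powr_powr)
  finally have "B * r powr a \<le> B * (e / (B + 1))" using assms by (intro mult_left_mono)
  also have "\<dots> \<le> e" using assms by (simp add: field_simps)
  finally show ?thesis using r by blast
qed

lemma hausdorff_outer_mono: "A \<subseteq> B \<Longrightarrow> hausdorff_outer s A \<le> hausdorff_outer s B"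
  unfolding hausdorff_outer_def by (rule cara_outer_mono)

lemma hausdorff_dim_mono: "A \<subseteq> B \<Longrightarrow> hausdorff_dim A \<le> hausdorff_dim B"
  unfolding hausdorff_dim_def
  using hausdorff_outer_mono[of A B] by (intro INF_superset_mono) (auto, metis le_zero_eq)

section \<open>Measures of variable regularity\<close>

text \<open>
  Ahlfors regularity in a normalised form: a finite measure, real-valued estimates, and only radii up to
  a bound \<open>R \<le> 1 / 2\<close>, so that all powers that occur are decreasing in the exponent.
\<close>
locale variable_regular = finite_measure \<nu>
  for \<nu> :: "'a::metric_space measure" +
  fixes Q :: "'a \<Rightarrow> real" and C R M :: real
  assumes compact_UNIV: "compact (UNIV :: 'a set)"
    and sets_nu: "sets \<nu> = sets borel"
    and C_ge_1: "1 \<le> C"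
    and R_pos: "0 < R" and R_le: "R \<le> 1 / 2"
    and Q_pos: "0 < Q x" and Q_le: "Q x \<le> M"
    and lower: "0 < r \<Longrightarrow> r \<le> R \<Longrightarrow> r powr Q x \<le> C * measure \<nu> (ball x r)"
    and upper: "0 < r \<Longrightarrow> r \<le> R \<Longrightarrow> measure \<nu> (ball x r) \<le> C * r powr Q x"
begin

lemma borel_sets_nu [simp]: "open S \<Longrightarrow> S \<in> sets \<nu>" "closed S \<Longrightarrow> S \<in> sets \<nu>"
  by (auto simp: sets_nu)

lemma measure_ball_pos: "0 < r \<Longrightarrow> 0 < measure \<nu> (ball x r)"
proof -
  assume r: "0 < r"
  define \<rho> where "\<rho> = min r R"
  have \<rho>: "0 < \<rho>" "\<rho> \<le> R" "\<rho> \<le> r" using r R_pos by (auto simp: \<rho>_def)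
  have "0 < \<rho> powr Q x" using \<rho> by simp
  also have "\<dots> \<le> C * measure \<nu> (ball x \<rho>)" using \<rho> by (intro lower)
  finally have "0 < measure \<nu> (ball x \<rho>)" using C_ge_1 by (simp add: zero_less_mult_iff)
  also have "\<dots> \<le> measure \<nu> (ball x r)" using \<rho> by (intro finite_measure_mono subset_ball) auto
  finally show ?thesis .
qed

subsection \<open>Oscillation of the exponent\<close>

definition K :: real where "K = C\<^sup>2 * 2 powr M"

text \<open>
  The value is chosen so that \<open>r powr osc r = 1 / K\<close> for \<open>0 < r < 1\<close>.
\<close>
definition osc :: "real \<Rightarrow> real" where "osc r = ln K / ln (1 / r)"

lemma M_pos: "0 < M"
  using Q_pos Q_le by (rule less_le_trans)

lemma K_ge_1: "1 \<le> K"
proof -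
  have "1 \<le> C\<^sup>2" using C_ge_1 by (rule one_le_power)
  moreover have "1 \<le> 2 powr M" using M_pos by (intro ge_one_powr_ge_zero) auto
  ultimately have "1 * 1 \<le> C\<^sup>2 * 2 powr M" by (intro mult_mono) auto
  then show ?thesis by (simp add: K_def)
qed

lemma powr_scale_le:
  assumes "1 \<le> c" "0 < r"
  shows "(c * r) powr Q x \<le> c powr M * r powr Q x"
  using assms Q_le[of x] by (simp add: powr_mult mult_right_mono powr_mono)

text \<open>
  Evaluate the measure of \<open>ball x r \<subseteq> ball y (2 * r)\<close> from below at \<open>x\<close> and from
  above at \<open>y\<close>. Each estimate contributes a factor \<open>C\<close> to \<open>K\<close>, the doubled radius at most \<open>2 powr M\<close>.
\<close>
lemma powr_exponent_compare:
  assumes "dist x y \<le> r" "0 < r" "r \<le> R / 2"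
  shows "r powr Q x \<le> K * r powr Q y"
proof -
  have "r powr Q x \<le> C * measure \<nu> (ball x r)"
    using assms R_pos by (intro lower) auto
  also have "\<dots> \<le> C * measure \<nu> (ball y (2 * r))"
  proof (intro mult_left_mono finite_measure_mono subsetI)
    fix z assume "z \<in> ball x r"
    then show "z \<in> ball y (2 * r)"
      using assms(1) dist_triangle[of y z x] by (simp add: dist_commute)
  qed (use C_ge_1 in auto)
  also have "\<dots> \<le> C * (C * (2 * r) powr Q y)"
    using assms C_ge_1 by (intro mult_left_mono upper) auto
  also have "\<dots> \<le> C * (C * (2 powr M * r powr Q y))"
    using assms C_ge_1 by (intro mult_left_mono powr_scale_le) auto
  finally show ?thesis by (simp add: K_def power2_eq_square mult_ac)
qed

lemma osc_nonneg: "0 < r \<Longrightarrow> r < 1 \<Longrightarrow> 0 \<le> osc r"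
  unfolding osc_def using K_ge_1 by (intro divide_nonneg_nonneg) (auto simp: ln_div)

lemma powr_osc:
  assumes "0 < r" "r < 1"
  shows "r powr osc r = 1 / K"
proof -
  have "ln r < 0" using assms by simp
  then have "osc r * ln r = - ln K"
    using assms by (simp add: osc_def ln_div)
  then have "r powr osc r = exp (- ln K)" using assms by (simp add: powr_def)
  then show ?thesis using K_ge_1 by (simp add: exp_minus inverse_eq_divide)
qed

lemma Q_le_osc:
  assumes "dist x y \<le> r" "0 < r" "r \<le> R / 2"
  shows "Q y \<le> Q x + osc r"
proof -
  have r: "r < 1" "ln r < 0" using assms R_le by auto
  have "ln (r powr Q x) \<le> ln (K * r powr Q y)"
    using powr_exponent_compare[OF assms] assms(2) K_ge_1 by (subst ln_le_cancel_iff) auto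
  then have "Q x * ln r \<le> ln K + Q y * ln r"
    using assms(2) K_ge_1 by (simp add: ln_powr ln_mult)
  then have "(Q y - Q x) * (- ln r) \<le> ln K" by (simp add: algebra_simps)
  then have "Q y - Q x \<le> ln K / (- ln r)" using r by (subst pos_le_divide_eq) auto
  also have "ln K / (- ln r) = osc r" using assms(2) by (simp add: osc_def ln_div)
  finally show ?thesis by simp
qed

lemma ex_osc_le:
  assumes "0 < e"
  shows "\<exists>r. 0 < r \<and> r \<le> R / 2 \<and> osc r \<le> e"
proof -
  define r where "r = min (R / 2) (exp (- (ln K / e)))"
  have r: "0 < r" "r \<le> R / 2" "r < 1" using R_pos R_le by (auto simp: r_def)
  have "ln r \<le> ln (exp (- (ln K / e)))"
    using r(1) by (subst ln_le_cancel_iff) (auto simp: r_def)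
  then have "ln K / e \<le> ln (1 / r)" using r by (simp add: ln_div)
  then have "ln K \<le> e * ln (1 / r)" using assms by (simp add: pos_divide_le_eq mult.commute)
  then have "osc r \<le> e"
    using r unfolding osc_def by (subst pos_divide_le_eq) (auto simp: ln_div)
  then show ?thesis using r by blast
qed

subsection \<open>Comparison of covers with the measure\<close>

lemma measure_singleton: "measure \<nu> {x} = 0"
proof (rule antisym)
  show "measure \<nu> {x} \<le> 0"
  proof (rule field_le_epsilon)
    fix e :: real assume "0 < e"
    then obtain r where r: "0 < r" "r \<le> R" "C * r powr Q x \<le> e"
      using ex_small_powr[of "Q x" C e R] Q_pos C_ge_1 R_pos by auto
    have "measure \<nu> {x} \<le> measure \<nu> (ball x r)"
      using r by (intro finite_measure_mono) auto
    also have "\<dots> \<le> e" using upper[of r x] r by simp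
    finally show "measure \<nu> {x} \<le> 0 + e" by simp
  qed
qed simp

text \<open>
  The hypothesis of the mass distribution principle for a set \<open>U\<close> of diameter \<open>d\<close>. For \<open>d > 0\<close>
  the ball of radius \<open>2 * d\<close> about a point of \<open>U\<close> serves as hull. For \<open>d = 0\<close> that ball is
  empty, and the set is a single point, which has measure zero because \<open>Q x > 0\<close>.
\<close>
lemma ex_enclosing_set:
  assumes "x \<in> U" "ediam U \<le> ennreal (R / 2)" "0 \<le> L"
    and pow: "\<And>d. 0 < d \<Longrightarrow> d \<le> R / 2 \<Longrightarrow> ediam U = ennreal d \<Longrightarrow>
      ennreal (d powr Q x) \<le> ennreal L * epow (ediam U) a"
  shows "\<exists>V\<in>sets \<nu>. U \<subseteq> V \<and> emeasure \<nu> V \<le> ennreal (C * 2 powr M * L) * epow (ediam U) a"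
proof -
  have "ediam U < top" using assms(2) ennreal_less_top by (rule le_less_trans)
  then obtain d where d: "0 \<le> d" "ediam U = ennreal d"
    by (cases "ediam U") auto
  have d_le: "d \<le> R / 2" using assms(2) d R_pos by simp
  have dist_le: "dist x y \<le> d" if "y \<in> U" for y
    using dist_le_ediam[OF assms(1) that] d by simp
  show ?thesis
  proof (cases "d = 0")
    case True
    then have "U \<subseteq> {x}" using dist_le by fastforce
    moreover have "emeasure \<nu> {x} = 0" by (simp add: emeasure_eq_measure measure_singleton)
    ultimately show ?thesis by (intro bexI[of _ "{x}"]) auto
  next
    case False
    with d have "0 < d" by simp
    have "U \<subseteq> ball x (2 * d)" using dist_le \<open>0 < d\<close> by fastforce
    moreover have "emeasure \<nu> (ball x (2 * d)) \<le> ennreal (C * 2 powr M * L) * epow (ediam U) a"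
    proof -
      have "measure \<nu> (ball x (2 * d)) \<le> C * (2 * d) powr Q x"
        using \<open>0 < d\<close> d_le by (intro upper) auto
      also have "\<dots> \<le> C * (2 powr M * d powr Q x)"
        using \<open>0 < d\<close> C_ge_1 by (intro mult_left_mono powr_scale_le) auto
      finally have "emeasure \<nu> (ball x (2 * d)) \<le> ennreal (C * 2 powr M * d powr Q x)"
        by (auto simp: emeasure_eq_measure mult_ac intro: ennreal_leI)
      also have "\<dots> = ennreal (C * 2 powr M) * ennreal (d powr Q x)"
        using C_ge_1 by (intro ennreal_mult) auto
      also have "\<dots> \<le> ennreal (C * 2 powr M) * (ennreal L * epow (ediam U) a)"
        using \<open>0 < d\<close> d_le d(2) by (intro mult_left_mono pow) auto
      also have "\<dots> = ennreal (C * 2 powr M * L) * epow (ediam U) a"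
        using C_ge_1 \<open>0 \<le> L\<close> by (subst (2) ennreal_mult) (auto simp: mult.assoc)
      finally show ?thesis .
    qed
    ultimately show ?thesis by (intro bexI[of _ "ball x (2 * d)"]) auto
  qed
qed

text \<open>
  The balls of radius \<open>2 * r\<close> about a separated net in \<open>A\<close> cover \<open>A\<close>. Their weights are charged to the
  concentric balls of radius \<open>r\<close>, which are disjoint and stay in the \<open>r\<close>-neighbourhood of \<open>A\<close>.
\<close>
lemma cara_pre_le_measure_neighbourhood:
  assumes r: "0 < r" "r \<le> R" and "0 \<le> L"
    and bound: "\<And>x. x \<in> A \<Longrightarrow> \<tau> (ball x (2 * r)) \<le> ennreal (L * r powr Q x)"
  shows "cara_pre \<tau> (4 * r) A \<le> ennreal (L * C * measure \<nu> (\<Union>x\<in>A. ball x r))"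
proof -
  obtain S where S: "finite S" "S \<subseteq> A" "A \<subseteq> (\<Union>x\<in>S. ball x (2 * r))"
      "disjoint_family_on (\<lambda>x. ball x r) S"
    using obtain_separated_net[OF compact_UNIV r(1)] .
  let ?U = "(\<lambda>x. ball x (2 * r)) ` S"
  have "?U \<in> covers (4 * r) A"
    using S r ediam_ball_le[of "2 * r"] by (auto simp: covers_def countable_finite)
  then have "cara_pre \<tau> (4 * r) A \<le> infsum \<tau> ?U" by (rule cara_pre_le_infsum)
  also have "\<dots> = sum \<tau> ?U" using S(1) by simp
  also have "\<dots> \<le> sum (\<tau> \<circ> (\<lambda>x. ball x (2 * r))) S"
    using S(1) by (intro sum_image_le) auto
  also have "\<dots> \<le> (\<Sum>x\<in>S. ennreal (L * r powr Q x))"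
    using S(2) bound by (intro sum_mono) auto
  also have "\<dots> = ennreal (\<Sum>x\<in>S. L * r powr Q x)"
    using \<open>0 \<le> L\<close> by (intro sum_ennreal) auto
  also have "\<dots> \<le> ennreal (L * C * measure \<nu> (\<Union>x\<in>A. ball x r))"
  proof (rule ennreal_leI)
    have "(\<Sum>x\<in>S. L * r powr Q x) \<le> (\<Sum>x\<in>S. L * (C * measure \<nu> (ball x r)))"
      using r \<open>0 \<le> L\<close> by (intro sum_mono mult_left_mono lower) auto
    also have "\<dots> = L * C * (\<Sum>x\<in>S. measure \<nu> (ball x r))"
      by (simp add: sum_distrib_left mult.assoc)
    also have "(\<Sum>x\<in>S. measure \<nu> (ball x r)) = measure \<nu> (\<Union>x\<in>S. ball x r)"
      using S by (intro finite_measure_finite_Union[symmetric]) auto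
    also have "L * C * \<dots> \<le> L * C * measure \<nu> (\<Union>x\<in>A. ball x r)"
      using S(2) \<open>0 \<le> L\<close> C_ge_1
      by (intro mult_left_mono finite_measure_mono borel_sets_nu open_UN) auto
    finally show "(\<Sum>x\<in>S. L * r powr Q x) \<le> L * C * measure \<nu> (\<Union>x\<in>A. ball x r)" .
  qed
  finally show ?thesis .
qed

subsection \<open>Hausdorff dimension and the exponent\<close>

text \<open>
  For \<open>0 \<le> s < q\<close> a set of diameter \<open>d\<close> about a point \<open>x\<close> of \<open>A\<close> has measure at most of order
  \<open>d powr Q x \<le> d powr s\<close>, so the mass distribution principle forbids \<open>hausdorff_outer s A = 0\<close>.
\<close>
lemma hausdorff_dim_ge:
  assumes "0 < emeasure \<nu> A" and q: "\<And>x. x \<in> A \<Longrightarrow> q \<le> Q x"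
  shows "ennreal q \<le> hausdorff_dim A"
  unfolding hausdorff_dim_def
proof (rule INF_greatest, clarify)
  fix s :: real assume s: "0 \<le> s" "hausdorff_outer s A = 0"
  let ?\<tau> = "\<lambda>U::'a set. if U = {} then 0 else epow (ediam U) (ennreal s)"
  have "q \<le> s"
  proof (rule ccontr)
    assume "\<not> q \<le> s"
    have "emeasure \<nu> A \<le> ennreal (C * 2 powr M * 1) * cara_outer ?\<tau> A"
    proof (rule emeasure_le_cara_outer)
      show "0 < R / 2" using R_pos by simp
      show "0 < ennreal (C * 2 powr M * 1)" using C_ge_1 by simp
      fix U assume U: "U \<inter> A \<noteq> {}" "ediam U \<le> ennreal (R / 2)"
      then obtain x where x: "x \<in> U" "x \<in> A" by blast
      have "\<exists>V\<in>sets \<nu>. U \<subseteq> V \<and>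
          emeasure \<nu> V \<le> ennreal (C * 2 powr M * 1) * epow (ediam U) (ennreal s)"
      proof (rule ex_enclosing_set[OF x(1) U(2)])
        fix d :: real assume d: "0 < d" "d \<le> R / 2" "ediam U = ennreal d"
        have "d powr Q x \<le> d powr s"
          using d R_le q[OF x(2)] \<open>\<not> q \<le> s\<close> by (intro powr_mono') auto
        also have "ennreal \<dots> \<le> epow (ennreal d) (ennreal s)"
          using d R_le s by (intro powr_le_epow) auto
        finally show "ennreal (d powr Q x) \<le> ennreal 1 * epow (ediam U) (ennreal s)"
          using d(3) by (simp add: ennreal_leI)
      qed simp
      then show "\<exists>V\<in>sets \<nu>. U \<subseteq> V \<and> emeasure \<nu> V \<le> ennreal (C * 2 powr M * 1) * ?\<tau> U"
        using x(1) by auto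
    qed simp
    also have "cara_outer ?\<tau> A = 0" using s(2) by (simp add: hausdorff_outer_def)
    finally show False using assms(1) by simp
  qed
  then show "ennreal q \<le> ennreal s" by (rule ennreal_leI)
qed

text \<open>
  For \<open>s = q + e\<close> the net cover at scale \<open>r\<close> has a sum of order \<open>r powr e\<close> times the total measure,
  which tends to zero with \<open>r\<close>.
\<close>
lemma hausdorff_dim_le:
  assumes "0 \<le> q" and q: "\<And>x. x \<in> A \<Longrightarrow> Q x \<le> q"
  shows "hausdorff_dim A \<le> ennreal q"
proof (rule ennreal_le_epsilon)
  fix e :: real assume "0 < e"
  define s where "s = q + e"
  have s: "0 < s" using assms(1) \<open>0 < e\<close> by (simp add: s_def)
  let ?\<tau> = "\<lambda>U::'a set. if U = {} then 0 else epow (ediam U) (ennreal s)"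
  have "hausdorff_outer s A \<le> 0"
    unfolding hausdorff_outer_def cara_outer_def
  proof (rule SUP_least, rule ennreal_le_epsilon)
    fix \<delta> \<epsilon> :: real assume "\<delta> \<in> {0<..}" "0 < \<epsilon>"
    then have "0 < min (R / 2) (\<delta> / 4)" using R_pos by simp
    then obtain r where r: "0 < r" "r \<le> min (R / 2) (\<delta> / 4)"
        "4 powr s * C * measure \<nu> UNIV * r powr e \<le> \<epsilon>"
      using ex_small_powr[of e "4 powr s * C * measure \<nu> UNIV" \<epsilon> "min (R / 2) (\<delta> / 4)"]
        \<open>0 < e\<close> \<open>0 < \<epsilon>\<close> C_ge_1
      by auto
    have r': "r \<le> R" "4 * r \<le> 1" "4 * r \<le> \<delta>" using r R_le R_pos by auto
    have "cara_pre ?\<tau> \<delta> A \<le> cara_pre ?\<tau> (4 * r) A"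
      using r'(3) by (rule cara_pre_antimono)
    also have "\<dots> \<le> ennreal ((4 powr s * r powr e) * C * measure \<nu> (\<Union>x\<in>A. ball x r))"
    proof (rule cara_pre_le_measure_neighbourhood)
      fix x assume "x \<in> A"
      have "epow (ediam (ball x (2 * r))) (ennreal s) \<le> ennreal ((4 * r) powr s)"
        using r r' ediam_ball_le[of "2 * r" x] by (intro epow_le_powr) auto
      also have "\<dots> \<le> ennreal (4 powr s * r powr e * r powr Q x)"
      proof (rule ennreal_leI)
        have "(4 * r) powr s = 4 powr s * r powr e * r powr q"
          using r(1) by (simp add: powr_mult s_def powr_add)
        also have "\<dots> \<le> 4 powr s * r powr e * r powr Q x"
          using r(1) r' q[OF \<open>x \<in> A\<close>] by (intro mult_left_mono powr_mono') auto
        finally show "(4 * r) powr s \<le> 4 powr s * r powr e * r powr Q x" .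
      qed
      finally show "?\<tau> (ball x (2 * r)) \<le> ennreal (4 powr s * r powr e * r powr Q x)" by simp
    qed (use r r' in auto)
    also have "\<dots> \<le> ennreal \<epsilon>"
    proof (rule ennreal_leI)
      have "(4 powr s * r powr e) * C * measure \<nu> (\<Union>x\<in>A. ball x r)
          \<le> (4 powr s * r powr e) * C * measure \<nu> UNIV"
        using C_ge_1 by (intro mult_left_mono finite_measure_mono borel_sets_nu) auto
      also have "\<dots> \<le> \<epsilon>" using r(3) by (simp add: mult_ac)
      finally show "(4 powr s * r powr e) * C * measure \<nu> (\<Union>x\<in>A. ball x r) \<le> \<epsilon>" .
    qed
    finally show "cara_pre ?\<tau> \<delta> A \<le> 0 + ennreal \<epsilon>" by simp
  qed
  then have "hausdorff_dim A \<le> ennreal s"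
    unfolding hausdorff_dim_def using s by (intro INF_lower) auto
  also have "\<dots> = ennreal q + ennreal e"
    using assms(1) \<open>0 < e\<close> by (simp add: s_def)
  finally show "hausdorff_dim A \<le> ennreal q + ennreal e" .
qed

lemma emeasure_ball_pos: "0 < r \<Longrightarrow> 0 < emeasure \<nu> (ball x r)"
  using measure_ball_pos[of r x] by (simp add: emeasure_eq_measure)

lemma local_dim_eq: "local_dim x = ennreal (Q x)"
proof (rule antisym)
  show "local_dim x \<le> ennreal (Q x)"
  proof (rule ennreal_le_epsilon)
    fix e :: real assume "0 < e"
    then obtain r where r: "0 < r" "r \<le> R / 2" "osc r \<le> e" using ex_osc_le by blast
    have "local_dim x \<le> hausdorff_dim (ball x r)"
      unfolding local_dim_def using r(1) by (intro INF_lower) auto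
    also have "\<dots> \<le> ennreal (Q x + e)"
    proof (rule hausdorff_dim_le)
      show "0 \<le> Q x + e" using Q_pos[of x] \<open>0 < e\<close> by simp
      show "Q y \<le> Q x + e" if "y \<in> ball x r" for y
        using Q_le_osc[of x y r] that r by auto
    qed
    also have "\<dots> = ennreal (Q x) + ennreal e"
      using Q_pos[of x] \<open>0 < e\<close> by (intro ennreal_plus) auto
    finally show "local_dim x \<le> ennreal (Q x) + ennreal e" .
  qed
  show "ennreal (Q x) \<le> local_dim x"
    unfolding local_dim_def
  proof (rule INF_greatest, clarify)
    fix U :: "'a set" assume U: "open U" "x \<in> U"
    show "ennreal (Q x) \<le> hausdorff_dim U"
    proof (rule ennreal_le_epsilon)
      fix e :: real assume "0 < e"
      then obtain r where r: "0 < r" "r \<le> R / 2" "osc r \<le> e" using ex_osc_le by blast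
      obtain \<rho> where \<rho>: "0 < \<rho>" "ball x \<rho> \<subseteq> U" using U open_contains_ball by blast
      have "ennreal (Q x - e) \<le> hausdorff_dim (ball x (min r \<rho>))"
      proof (rule hausdorff_dim_ge)
        show "0 < emeasure \<nu> (ball x (min r \<rho>))" using r \<rho> by (intro emeasure_ball_pos) auto
        show "Q x - e \<le> Q y" if "y \<in> ball x (min r \<rho>)" for y
          using Q_le_osc[of y x r] that r by (auto simp: dist_commute)
      qed
      also have "\<dots> \<le> hausdorff_dim U"
        using \<rho>(2) by (intro hausdorff_dim_mono) auto
      finally have "ennreal (Q x - e) + ennreal e \<le> hausdorff_dim U + ennreal e"
        by (rule add_right_mono)
      moreover have "ennreal (Q x) \<le> ennreal (Q x - e) + ennreal e"
        using \<open>0 < e\<close> by (cases "0 \<le> Q x - e") (auto simp: ennreal_plus[symmetric] ennreal_neg simp del: ennreal_plus intro: ennreal_leI)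
      ultimately show "ennreal (Q x) \<le> hausdorff_dim U + ennreal e" by (rule order_trans[rotated])
    qed
  qed
qed

subsection \<open>The local Hausdorff measure\<close>
abbreviation local_gauge :: "'a set \<Rightarrow> ennreal" where
  "local_gauge \<equiv> \<lambda>U. if U = {} then 0 else epow (ediam U) (hausdorff_dim U)"

text \<open>
  On a set \<open>U\<close> of diameter \<open>d\<close> around \<open>x\<close> the exponent is at most \<open>Q x + osc d\<close>, so this number also bounds
  \<open>dim U\<close>, and the surplus \<open>osc d\<close> costs exactly the factor \<open>K\<close>.
\<close>
lemma emeasure_le_local_outer:
  "emeasure \<nu> A \<le> ennreal (C * 2 powr M * K) * cara_outer local_gauge A"
proof (rule emeasure_le_cara_outer)
  show "0 < R / 2" using R_pos by simp
  show "0 < ennreal (C * 2 powr M * K)" using C_ge_1 K_ge_1 by simp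
  fix U assume U: "U \<inter> A \<noteq> {}" "ediam U \<le> ennreal (R / 2)"
  then obtain x where x: "x \<in> U" by blast
  have "\<exists>V\<in>sets \<nu>. U \<subseteq> V \<and>
      emeasure \<nu> V \<le> ennreal (C * 2 powr M * K) * epow (ediam U) (hausdorff_dim U)"
  proof (rule ex_enclosing_set[OF x U(2)])
    show "0 \<le> K" using K_ge_1 by simp
    fix d :: real assume d: "0 < d" "d \<le> R / 2" "ediam U = ennreal d"
    have d1: "d < 1" using d R_le by simp
    have b: "0 \<le> Q x + osc d" using Q_pos[of x] osc_nonneg[OF d(1) d1] by simp
    have "hausdorff_dim U \<le> ennreal (Q x + osc d)"
    proof (rule hausdorff_dim_le[OF b])
      fix y assume "y \<in> U"
      then have "dist x y \<le> d" using dist_le_ediam[OF x] d by fastforce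
      then show "Q y \<le> Q x + osc d" using d(1,2) by (rule Q_le_osc)
    qed
    then have "ennreal (d powr (Q x + osc d)) \<le> epow (ediam U) (hausdorff_dim U)"
      unfolding d(3) using d(1) d1 b by (intro powr_le_epow) auto
    moreover have "d powr Q x = K * d powr (Q x + osc d)"
      using powr_osc[OF d(1) d1] K_ge_1 by (simp add: powr_add)
    ultimately show "ennreal (d powr Q x) \<le> ennreal K * epow (ediam U) (hausdorff_dim U)"
      using K_ge_1 by (simp add: ennreal_mult mult_left_mono)
  qed
  then show "\<exists>V\<in>sets \<nu>. U \<subseteq> V \<and> emeasure \<nu> V \<le> ennreal (C * 2 powr M * K) * local_gauge U"
    using x by auto
qed simp

text \<open>
  The dimension of a ball is at least \<open>Q x\<close> minus the oscillation of \<open>Q\<close> on it, which again costs the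
  factor \<open>K\<close>; the factor \<open>4 powr M\<close> accounts for the diameter being up to \<open>4 * r\<close>.
\<close>
lemma local_gauge_ball_le:
  assumes "0 < r" "r \<le> R / 4"
  shows "local_gauge (ball x (2 * r)) \<le> ennreal (4 powr M * K * r powr Q x)"
proof -
  have r: "4 * r \<le> 1" "2 * r < 1" using assms R_le by auto
  define b where "b = Q x - osc (2 * r)"
  have "ennreal b \<le> hausdorff_dim (ball x (2 * r))"
  proof (rule hausdorff_dim_ge)
    show "0 < emeasure \<nu> (ball x (2 * r))" using assms by (intro emeasure_ball_pos) auto
    show "b \<le> Q y" if "y \<in> ball x (2 * r)" for y
      using Q_le_osc[of y x "2 * r"] that assms by (auto simp: b_def dist_commute)
  qed
  then have "epow (ediam (ball x (2 * r))) (hausdorff_dim (ball x (2 * r))) \<le> ennreal ((4 * r) powr b)"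
    using assms r ediam_ball_le[of "2 * r" x] by (intro epow_le_powr) auto
  also have "\<dots> \<le> ennreal (4 powr M * K * r powr Q x)"
  proof (rule ennreal_leI)
    have "(4 * r) powr b = (4 * r) powr Q x * (4 * r) powr (- osc (2 * r))"
      by (simp add: b_def powr_add[symmetric])
    also have "\<dots> \<le> (4 powr M * r powr Q x) * (2 * r) powr (- osc (2 * r))"
      using assms r osc_nonneg[of "2 * r"]
      by (intro mult_mono powr_scale_le powr_mono2') auto
    also have "(2 * r) powr (- osc (2 * r)) = K"
      using powr_osc[of "2 * r"] assms r K_ge_1 by (simp add: powr_minus)
    finally show "(4 * r) powr b \<le> 4 powr M * K * r powr Q x" by (simp add: mult_ac)
  qed
  finally show ?thesis by simp
qed

text \<open>
  By outer regularity \<open>F\<close> has an open neighbourhood \<open>G\<close> of nearly the same measure, and by compactness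
  \<open>G\<close> contains the \<open>r\<close>-neighbourhood of \<open>F\<close> for small \<open>r\<close>; net covers at scale \<open>r\<close> then suffice.
\<close>
lemma local_outer_le_emeasure_closed:
  assumes F: "closed F"
  shows "cara_outer local_gauge F \<le> ennreal (4 powr M * K * C) * emeasure \<nu> F"
  unfolding cara_outer_def
proof (rule SUP_least, rule ennreal_le_epsilon)
  fix \<delta> e :: real assume "\<delta> \<in> {0<..}" "0 < e"
  then have "0 < \<delta>" by simp
  define B where "B = 4 powr M * K * C"
  have B: "0 < B" using K_ge_1 C_ge_1 by (simp add: B_def)
  have "0 < e / B" using \<open>0 < e\<close> B by simp
  moreover have "F \<in> sets borel" using F by simp
  ultimately obtain F' G where G: "open G" "closed F'" "F' \<subseteq> F" "F \<subseteq> G" "measure \<nu> (G - F') < e / B"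
    using finite_borel_measure_closed_open_approx[OF finite_measure_axioms sets_nu] by meson
  have "compact F" using F compact_UNIV compact_Int_closed[of UNIV F] by simp
  then obtain \<rho> where \<rho>: "0 < \<rho>" "(\<Union>x\<in>F. ball x \<rho>) \<subseteq> G"
    using compact_subset_open_imp_ball_epsilon_subset[OF _ G(1) G(4)] by metis
  define r where "r = min \<rho> (min (R / 4) (\<delta> / 4))"
  have r: "0 < r" "r \<le> \<rho>" "r \<le> R / 4" "4 * r \<le> \<delta>"
    using \<rho>(1) R_pos \<open>0 < \<delta>\<close> by (auto simp: r_def)
  have "(\<Union>x\<in>F. ball x r) \<subseteq> (\<Union>x\<in>F. ball x \<rho>)"
    using r(2) by (intro UN_mono subset_ball) auto
  then have sub: "(\<Union>x\<in>F. ball x r) \<subseteq> F \<union> (G - F')"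
    using \<rho>(2) G(3) by blast
  have "cara_pre local_gauge \<delta> F \<le> cara_pre local_gauge (4 * r) F"
    using r(4) by (rule cara_pre_antimono)
  also have "\<dots> \<le> ennreal (B * measure \<nu> (\<Union>x\<in>F. ball x r))"
    unfolding B_def
    using r R_pos K_ge_1 by (intro cara_pre_le_measure_neighbourhood local_gauge_ball_le) auto
  also have "\<dots> \<le> ennreal (B * measure \<nu> F + e)"
  proof (rule ennreal_leI)
    have "measure \<nu> (\<Union>x\<in>F. ball x r) \<le> measure \<nu> (F \<union> (G - F'))"
      using sub F G(1,2) by (intro finite_measure_mono sets.Un sets.Diff) auto
    also have "\<dots> \<le> measure \<nu> F + measure \<nu> (G - F')"
      using F G(1,2) by (intro measure_Un_le sets.Diff) auto
    also have "\<dots> \<le> measure \<nu> F + e / B" using G(5) by simp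
    finally have "B * measure \<nu> (\<Union>x\<in>F. ball x r) \<le> B * (measure \<nu> F + e / B)"
      using B by (intro mult_left_mono) auto
    also have "\<dots> = B * measure \<nu> F + e" using B by (simp add: field_simps)
    finally show "B * measure \<nu> (\<Union>x\<in>F. ball x r) \<le> B * measure \<nu> F + e" .
  qed
  also have "\<dots> = ennreal B * emeasure \<nu> F + ennreal e"
    using B \<open>0 < e\<close> by (simp add: emeasure_eq_measure ennreal_mult)
  finally show "cara_pre local_gauge \<delta> F \<le> ennreal (4 powr M * K * C) * emeasure \<nu> F + ennreal e"
    by (simp add: B_def)
qed

lemma strongly_equivalent_local_hausdorff_measure:
  "strongly_equivalent \<nu> local_hausdorff_measure"
proof -
  let ?H = "local_hausdorff_measure :: 'a measure"
  have H: "emeasure ?H E = cara_outer local_gauge E" if "E \<in> sets borel" for E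
    using that unfolding local_hausdorff_measure_def by (rule emeasure_cara_measure)
  have sets_H: "sets ?H = sets borel"
    unfolding local_hausdorff_measure_def by (rule sets_cara_measure)
  define B where "B = 4 powr M * K * C"
  have B: "0 < B" using K_ge_1 C_ge_1 by (simp add: B_def)
  have closed: "emeasure ?H F \<le> ennreal B * emeasure \<nu> F" if "closed F" for F
    using local_outer_le_emeasure_closed[OF that] H that by (simp add: B_def)
  have "finite_measure ?H"
  proof
    have "emeasure ?H UNIV \<le> ennreal B * emeasure \<nu> UNIV" by (rule closed) simp
    also have "\<dots> < top" by (simp add: emeasure_eq_measure ennreal_mult_less_top)
    finally show "emeasure ?H (space ?H) \<noteq> \<infinity>"
      using sets_eq_imp_space_eq[OF sets_H] by simp
  qed
  then have le: "emeasure ?H E \<le> ennreal B * emeasure \<nu> E" if "E \<in> sets borel" for E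
    using sets_H sets_nu closed that by (rule emeasure_le_of_closed)
  have ge: "emeasure \<nu> E \<le> ennreal (C * 2 powr M * K) * emeasure ?H E" if "E \<in> sets borel" for E
    using emeasure_le_local_outer[of E] H[OF that] by simp
  have CB: "C * 2 powr M * K \<le> B"
  proof -
    have "(2::real) powr M \<le> 4 powr M" using M_pos by (intro powr_mono2) auto
    then show ?thesis using C_ge_1 K_ge_1 by (simp add: B_def mult_ac mult_left_mono)
  qed
  show ?thesis
    unfolding strongly_equivalent_def
  proof (intro exI[of _ B] conjI ballI B)
    fix E :: "'a set" assume E: "E \<in> sets borel"
    have "ennreal (1 / B) * emeasure ?H E \<le> ennreal (1 / B) * (ennreal B * emeasure \<nu> E)"
      using le[OF E] by (rule mult_left_mono) simp
    also have "\<dots> = emeasure \<nu> E"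
      using B by (simp add: mult.assoc[symmetric] ennreal_mult[symmetric])
    finally show "ennreal (1 / B) * emeasure ?H E \<le> emeasure \<nu> E" .
    have "emeasure \<nu> E \<le> ennreal (C * 2 powr M * K) * emeasure ?H E" by (rule ge[OF E])
    also have "\<dots> \<le> ennreal B * emeasure ?H E"
      using CB by (intro mult_right_mono ennreal_leI) auto
    finally show "emeasure \<nu> E \<le> ennreal B * emeasure ?H E" .
  qed
qed

end

section \<open>Ahlfors regular measures\<close>

text \<open>
  Two distinct points make the diameter of the space positive, which leaves room for a radius \<open>R > 0\<close> at
  which regularity applies. Finiteness of the measure follows from a finite cover by balls of radius \<open>R\<close>.
\<close>
lemma ahlfors_regular_imp_variable_regular:
  fixes Q :: "'a::metric_space \<Rightarrow> real" and \<nu> :: "'a measure"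
  assumes compact: "compact (UNIV :: 'a set)"
    and ex: "\<exists>x y :: 'a. x \<noteq> y"
    and Q: "\<forall>x. 0 < Q x" "bounded (range Q)"
    and "borel_measure \<nu>" "ahlfors_regular Q \<nu>"
  shows "\<exists>C R M. variable_regular \<nu> Q C R M"
proof -
  obtain x0 y0 :: 'a where "x0 \<noteq> y0" using ex by blast
  have sets: "sets \<nu> = sets borel" using assms(5) by (simp add: borel_measure_def)
  define R where "R = min (1 / 2) (dist x0 y0)"
  have R: "0 < R" "R \<le> 1 / 2" using \<open>x0 \<noteq> y0\<close> by (auto simp: R_def)
  have "ennreal R \<le> ennreal (dist x0 y0)" by (intro ennreal_leI) (simp add: R_def)
  also have "\<dots> \<le> ediam (UNIV :: 'a set)" by (rule dist_le_ediam) auto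
  finally have R_diam: "ennreal r \<le> ediam (UNIV :: 'a set)" if "r \<le> R" for r
    using that by (meson ennreal_leI order_trans)
  obtain D :: real where D: "0 < D"
      "\<And>x r. 0 < r \<Longrightarrow> r \<le> R \<Longrightarrow> ennreal (1 / D) * emeasure \<nu> (ball x r) \<le> ennreal (r powr Q x)"
      "\<And>x r. 0 < r \<Longrightarrow> r \<le> R \<Longrightarrow> ennreal (r powr Q x) \<le> ennreal D * emeasure \<nu> (ball x r)"
    using assms(6) R_diam unfolding ahlfors_regular_def by metis
  have up: "emeasure \<nu> (ball x r) \<le> ennreal (D * r powr Q x)" if "0 < r" "r \<le> R" for x r
  proof -
    have "emeasure \<nu> (ball x r) = ennreal D * (ennreal (1 / D) * emeasure \<nu> (ball x r))"
      using D(1) by (simp add: mult.assoc[symmetric] ennreal_mult[symmetric])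
    also have "\<dots> \<le> ennreal D * ennreal (r powr Q x)"
      using D(2)[OF that] by (rule mult_left_mono) simp
    also have "\<dots> = ennreal (D * r powr Q x)"
      using D(1) by (simp add: ennreal_mult)
    finally show ?thesis .
  qed
  have fin: "finite_measure \<nu>"
  proof
    have "\<exists>T. finite T \<and> (UNIV :: 'a set) \<subseteq> (\<Union>t\<in>T. ball t R)"
      using compact[unfolded compact_eq_totally_bounded] R(1) by simp
    then obtain T where T: "finite T" "(UNIV :: 'a set) \<subseteq> (\<Union>t\<in>T. ball t R)"
      by (elim exE conjE)
    have "emeasure \<nu> (space \<nu>) \<le> emeasure \<nu> (\<Union>t\<in>T. ball t R)"
      using T(2) by (intro emeasure_mono) (auto simp: sets intro!: borel_open open_UN)
    also have "\<dots> \<le> (\<Sum>t\<in>T. emeasure \<nu> (ball t R))"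
      using T(1) by (intro emeasure_subadditive_finite) (auto simp: sets)
    also have "\<dots> \<le> (\<Sum>t\<in>T. ennreal (D * R powr Q t))"
      using R by (intro sum_mono up) auto
    also have "\<dots> < top" using T(1) by (simp add: sum_ennreal D(1) less_imp_le)
    finally show "emeasure \<nu> (space \<nu>) \<noteq> \<infinity>" by simp
  qed
  then interpret finite_measure \<nu> .
  obtain M where M: "\<And>x. \<bar>Q x\<bar> \<le> M"
    using Q(2) by (auto simp: bounded_iff)
  define C where "C = max 1 D"
  have "variable_regular \<nu> Q C R M"
  proof
    show "compact (UNIV :: 'a set)" "sets \<nu> = sets borel" by fact+
    show "1 \<le> C" "0 < R" "R \<le> 1 / 2" using R by (auto simp: C_def)
    show "0 < Q x" "Q x \<le> M" for x using Q(1) M[of x] by auto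
    fix r x assume r: "0 < r" "r \<le> R"
    have "r powr Q x \<le> D * measure \<nu> (ball x r)"
      using D(3)[OF r, of x] D(1) by (simp add: emeasure_eq_measure ennreal_mult[symmetric])
    also have "\<dots> \<le> C * measure \<nu> (ball x r)" by (intro mult_right_mono) (auto simp: C_def)
    finally show "r powr Q x \<le> C * measure \<nu> (ball x r)" .
    have "measure \<nu> (ball x r) \<le> D * r powr Q x"
      using up[OF r, of x] D(1) by (simp add: emeasure_eq_measure)
    also have "\<dots> \<le> C * r powr Q x" by (intro mult_right_mono) (auto simp: C_def)
    finally show "measure \<nu> (ball x r) \<le> C * r powr Q x" .
  qed
  then show ?thesis by blast
qed

theorem theorem3p6:
  fixes Q :: "'a::metric_space \<Rightarrow> real" and \<nu> :: "'a measure"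
  assumes "compact (UNIV :: 'a set)"
    and "\<exists>x y :: 'a. x \<noteq> y"
    and "\<forall>x. 0 < Q x" and "bounded (range Q)"
    and "borel_measure \<nu>"
    and "ahlfors_regular Q \<nu>"
  shows "(\<forall>x. ennreal (Q x) = local_dim x) \<and>
         strongly_equivalent \<nu> local_hausdorff_measure"
proof -
  obtain C R M where "variable_regular \<nu> Q C R M"
    using ahlfors_regular_imp_variable_regular[OF assms] by blast
  then interpret variable_regular \<nu> Q C R M .
  show ?thesis
    using local_dim_eq strongly_equivalent_local_hausdorff_measure by simp
qed

end
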